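(* In the free Carnot group $\mathbb F_{23}$ of rank $2$ and step $3$ there exist a set $E$ with constant (horizontal) normal and a point $x$ such that $E$ admits distinct sub-Riemannian blow-ups at $x$. Moreover $\Theta_*(x,E)<\Theta^*(x,E)$.
   Context: $\mathbb F_{23}$ is the simply connected Lie group whose Lie algebra has basis $X_1,\dots,X_5$ with only nontrivial brackets $X_3=[X_2,X_1]$, $X_4=[X_3,X_1]$, $X_5=[X_3,X_2]$; it is a Carnot group with first layer $V_1=\mathrm{span}\{X_1,X_2\}$, and $\delta_t$ ($t>0$) is the group automorphism whose differential is multiplication by $t$ on $V_1$. $\mathrm{vol}$ is a Haar measure and $\rho$ a fixed Carnot distance (left-invariant sub-Riemannian distance with horizontal bundle induced by $V_1$). A measurable set $E$ has constant normal if there is a closed half-space $W\subset V_1$ (bounded by a line through the origin) such that for all $X\in W$ (as left-invariant vector fields), $X\mathbb 1_E\ge0$ in the sense of distributions, i.e. $-\int_E Xu\,d\mathrm{vol}\ge0$ for all $0\le u\in C_c^\infty$. A sub-Riemannian blow-up of $E$ at $x$ is any set $F$ such that $\mathbb 1_{\delta_{r_j}(x^{-1}E)}\to\mathbb 1_F$ in $L^1_{\rm loc}$ for some sequence $r_j\to+\infty$; blow-ups are identified if they agree up to a null set. $\Theta_*(x,E)$ and $\Theta^*(x,E)$ are the $\liminf$ and $\limsup$ as $r\to0^+$ of $\mathrm{vol}(B_\rho(x,r)\cap E)/\mathrm{vol}(B_\rho(x,r))$. *)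

theory Defs
  imports "HOL-Analysis.Analysis"
begin

section \<open>The free Carnot group of rank 2 and step 3\<close>

text \<open>
  The tuple \<open>(x1, x2, x3, x4, x5)\<close> stands both for the Lie algebra element
  \<open>x1 X1 + ... + x5 X5\<close> and for its image under the exponential map, which is a global
  diffeomorphism because the group is nilpotent and simply connected.  In these exponential
  coordinates (of the first kind) the exponential map is the identity.
\<close>

type_synonym f23 = "real \<times> real \<times> real \<times> real \<times> real"

definition X1 :: f23 where "X1 = (1, 0, 0, 0, 0)"
definition X2 :: f23 where "X2 = (0, 1, 0, 0, 0)"
definition X3 :: f23 where "X3 = (0, 0, 1, 0, 0)"
definition X4 :: f23 where "X4 = (0, 0, 0, 1, 0)"
definition X5 :: f23 where "X5 = (0, 0, 0, 0, 1)"

definition V1 :: "f23 set" where "V1 = span {X1, X2}"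

fun lie_bracket :: "f23 \<Rightarrow> f23 \<Rightarrow> f23" where
  "lie_bracket (x1, x2, x3, x4, x5) (y1, y2, y3, y4, y5) =
     (0, 0, x2 * y1 - x1 * y2, x3 * y1 - x1 * y3, x3 * y2 - x2 * y3)"

lemma lie_bracket_basis:
  "lie_bracket X2 X1 = X3" "lie_bracket X3 X1 = X4" "lie_bracket X3 X2 = X5"
  "lie_bracket X4 X1 = 0" "lie_bracket X5 X1 = 0" "lie_bracket X4 X2 = 0" "lie_bracket X5 X2 = 0"
  "lie_bracket X4 X3 = 0" "lie_bracket X5 X3 = 0" "lie_bracket X5 X4 = 0"
  by (simp_all add: X1_def X2_def X3_def X4_def X5_def zero_prod_def)

lemma bilinear_lie_bracket: "bilinear lie_bracket"
  unfolding bilinear_def by (auto intro!: linearI simp: algebra_simps)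

lemma lie_bracket_alternating: "lie_bracket x x = 0"
  by (cases x) (simp add: zero_prod_def)

lemma lie_bracket_jacobi:
  "lie_bracket x (lie_bracket y z) + lie_bracket y (lie_bracket z x)
     + lie_bracket z (lie_bracket x y) = 0"
  by (cases x; cases y; cases z) (simp add: zero_prod_def algebra_simps)

text \<open>The Baker--Campbell--Hausdorff formula, which stops at order 3 in step 3.\<close>

definition f23_mult :: "f23 \<Rightarrow> f23 \<Rightarrow> f23"  (infixl \<open>\<odot>\<close> 70) where
  "x \<odot> y = x + y + (1/2) *\<^sub>R lie_bracket x y
     + (1/12) *\<^sub>R lie_bracket x (lie_bracket x y) - (1/12) *\<^sub>R lie_bracket y (lie_bracket x y)"

definition f23_inv :: "f23 \<Rightarrow> f23" where "f23_inv x = - x"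

interpretation f23: group f23_mult 0 f23_inv
proof
  fix a b c :: f23
  show "a \<odot> b \<odot> c = a \<odot> (b \<odot> c)"
    by (cases a; cases b; cases c) (simp add: f23_mult_def field_simps)
  show "0 \<odot> a = a"
    by (cases a) (simp add: f23_mult_def zero_prod_def)
  show "f23_inv a \<odot> a = 0"
    by (cases a) (simp add: f23_mult_def f23_inv_def zero_prod_def)
qed

fun dilation :: "real \<Rightarrow> f23 \<Rightarrow> f23" where
  "dilation t (x1, x2, x3, x4, x5) = (t * x1, t * x2, t^2 * x3, t^3 * x4, t^3 * x5)"

lemma dilation_mult: "dilation t (x \<odot> y) = dilation t x \<odot> dilation t y"
  by (cases x; cases y) (simp add: f23_mult_def field_simps power2_eq_square power3_eq_cube)

lemma dilation_V1:
  assumes "v \<in> V1"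
  shows "dilation t v = t *\<^sub>R v"
proof -
  obtain a b where "v - a *\<^sub>R X1 = b *\<^sub>R X2"
    using assms by (auto simp: V1_def span_insert)
  then have "v = a *\<^sub>R X1 + b *\<^sub>R X2"
    by (simp add: algebra_simps)
  then show ?thesis
    by (simp add: X1_def X2_def)
qed

text \<open>The value at \<open>p\<close> of the left-invariant vector field determined by \<open>v\<close>.\<close>

definition left_inv_field :: "f23 \<Rightarrow> f23 \<Rightarrow> f23" where
  "left_inv_field v p = vector_derivative (\<lambda>t. p \<odot> (t *\<^sub>R v)) (at 0)"

lemma left_inv_field_eq:
  "left_inv_field v p =
     v + (1/2) *\<^sub>R lie_bracket p v + (1/12) *\<^sub>R lie_bracket p (lie_bracket p v)"
proof -
  have eq: "p \<odot> (t *\<^sub>R v) = p + t *\<^sub>R (v + (1/2) *\<^sub>R lie_bracket p v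
      + (1/12) *\<^sub>R lie_bracket p (lie_bracket p v))
      + (t * t) *\<^sub>R (- (1/12) *\<^sub>R lie_bracket v (lie_bracket p v))" for t
    by (cases p; cases v) (simp add: f23_mult_def field_simps)
  show ?thesis
    unfolding left_inv_field_def eq
    by (rule vector_derivative_at) (auto intro!: derivative_eq_intros)
qed

definition haar_measure :: "f23 measure \<Rightarrow> bool" where
  "haar_measure M \<longleftrightarrow>
     sets M = sets borel \<and> emeasure M UNIV \<noteq> 0 \<and>
     (\<forall>K. compact K \<longrightarrow> emeasure M K < \<infinity>) \<and>
     (\<forall>p. \<forall>A\<in>sets borel. emeasure M ((\<lambda>y. p \<odot> y) ` A) = emeasure M A)"


section \<open>Carnot distances\<close>

definition inner_product_on :: "f23 set \<Rightarrow> (f23 \<Rightarrow> f23 \<Rightarrow> real) \<Rightarrow> bool" where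
  "inner_product_on V g \<longleftrightarrow>
     (\<forall>u\<in>V. \<forall>v\<in>V. g u v = g v u) \<and>
     (\<forall>u\<in>V. \<forall>v\<in>V. \<forall>w\<in>V. g (u + v) w = g u w + g v w) \<and>
     (\<forall>c. \<forall>u\<in>V. \<forall>v\<in>V. g (c *\<^sub>R u) v = c * g u v) \<and>
     (\<forall>u\<in>V. u \<noteq> 0 \<longrightarrow> 0 < g u u)"

text \<open>
  \<open>h\<close> is the velocity of \<open>\<gamma>\<close>, read in the first layer by left translation; it is determined
  by \<open>\<gamma>\<close> up to finitely many times.
\<close>

definition horizontal_path :: "(real \<Rightarrow> f23) \<Rightarrow> (real \<Rightarrow> f23) \<Rightarrow> bool" where
  "horizontal_path \<gamma> h \<longleftrightarrow>
     valid_path \<gamma> \<and> (\<forall>t. h t \<in> V1) \<and>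
     (\<exists>S. finite S \<and>
        (\<forall>t\<in>{0..1} - S. (\<gamma> has_vector_derivative left_inv_field (h t) (\<gamma> t)) (at t)))"

text \<open>
  The integrability condition restricts the infimum to curves of finite length:
  \<^const>\<open>valid_path\<close> does not bound the derivative near the exceptional points, and
  \<^const>\<open>integral\<close> is 0 on non-integrable functions.
\<close>

definition cc_dist :: "(f23 \<Rightarrow> f23 \<Rightarrow> real) \<Rightarrow> f23 \<Rightarrow> f23 \<Rightarrow> real" where
  "cc_dist g p q = Inf {integral {0..1} (\<lambda>t. sqrt (g (h t) (h t))) | \<gamma> h.
     horizontal_path \<gamma> h \<and> pathstart \<gamma> = p \<and> pathfinish \<gamma> = q \<and>
     (\<lambda>t. sqrt (g (h t) (h t))) integrable_on {0..1}}"

definition carnot_distance :: "(f23 \<Rightarrow> f23 \<Rightarrow> real) \<Rightarrow> bool" where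
  "carnot_distance \<rho> \<longleftrightarrow> (\<exists>g. inner_product_on V1 g \<and> \<rho> = cc_dist g)"


section \<open>Constant normal, blow-ups, densities\<close>

primrec C_k :: "nat \<Rightarrow> (f23 \<Rightarrow> real) \<Rightarrow> bool" where
  "C_k 0 u \<longleftrightarrow> continuous_on UNIV u"
| "C_k (Suc k) u \<longleftrightarrow>
     (\<forall>p. u differentiable (at p)) \<and> (\<forall>v. C_k k (\<lambda>p. frechet_derivative u (at p) v))"

definition test_function :: "(f23 \<Rightarrow> real) \<Rightarrow> bool" where
  "test_function u \<longleftrightarrow> (\<forall>k. C_k k u) \<and> compact (closure {p. u p \<noteq> 0})"

definition half_space :: "f23 set \<Rightarrow> bool" where
  "half_space W \<longleftrightarrow> (\<exists>\<nu>\<in>V1. \<nu> \<noteq> 0 \<and> W = {v \<in> V1. 0 \<le> \<nu> \<bullet> v})"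

definition constant_normal :: "f23 measure \<Rightarrow> f23 set \<Rightarrow> bool" where
  "constant_normal vol E \<longleftrightarrow>
     E \<in> sets (completion vol) \<and>
     (\<exists>W. half_space W \<and>
        (\<forall>v\<in>W. \<forall>u. test_function u \<and> (\<forall>p. 0 \<le> u p) \<longrightarrow>
           0 \<le> - (LINT p:E|completion vol. frechet_derivative u (at p) (left_inv_field v p))))"

definition L1_loc_tendsto ::
    "f23 measure \<Rightarrow> (nat \<Rightarrow> f23 \<Rightarrow> real) \<Rightarrow> (f23 \<Rightarrow> real) \<Rightarrow> bool" where
  "L1_loc_tendsto vol f f' \<longleftrightarrow>
     (\<forall>K. compact K \<longrightarrow> (\<lambda>j. LINT p:K|completion vol. \<bar>f j p - f' p\<bar>) \<longlonglongrightarrow> 0)"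

definition blow_up :: "f23 measure \<Rightarrow> f23 set \<Rightarrow> f23 \<Rightarrow> f23 set \<Rightarrow> bool" where
  "blow_up vol E x F \<longleftrightarrow>
     F \<in> sets (completion vol) \<and>
     (\<exists>r. (\<forall>j. 0 < r j) \<and> filterlim r at_top sequentially \<and>
        L1_loc_tendsto vol
          (\<lambda>j. indicator (dilation (r j) ` (\<lambda>y. f23_inv x \<odot> y) ` E)) (indicator F))"

definition density_ratio ::
    "f23 measure \<Rightarrow> (f23 \<Rightarrow> f23 \<Rightarrow> real) \<Rightarrow> f23 \<Rightarrow> f23 set \<Rightarrow> real \<Rightarrow> ennreal" where
  "density_ratio vol \<rho> x E r =
     emeasure (completion vol) ({y. \<rho> x y < r} \<inter> E) / emeasure (completion vol) {y. \<rho> x y < r}"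

definition lower_density ::
    "f23 measure \<Rightarrow> (f23 \<Rightarrow> f23 \<Rightarrow> real) \<Rightarrow> f23 \<Rightarrow> f23 set \<Rightarrow> ennreal" where
  "lower_density vol \<rho> x E = Liminf (at_right 0) (density_ratio vol \<rho> x E)"

definition upper_density ::
    "f23 measure \<Rightarrow> (f23 \<Rightarrow> f23 \<Rightarrow> real) \<Rightarrow> f23 \<Rightarrow> f23 set \<Rightarrow> ennreal" where
  "upper_density vol \<rho> x E = Limsup (at_right 0) (density_ratio vol \<rho> x E)"

end

theory Submission
  imports Defs
begin

text \<open>
  In suitable polynomial coordinates a set is invariant under \<open>X2\<close> and monotone along \<open>X1\<close> as
  soon as it is of the form \<open>{p. h (inv4 p) < phi p}\<close> with \<open>h\<close> 1-Lipschitz on the line: translation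
  by an element of the half-space changes \<open>phi\<close> by at least as much as \<open>inv4\<close>.  Both functions are
  homogeneous of degree 3, so that dilating the set by \<open>r\<close> amounts to replacing \<open>h\<close> by
  \<open>\<lambda>x. r^3 * h (x / r^3)\<close>.  For \<open>h\<close> the distance to a set that looks, at alternating scales, like the
  whole line and like a half-line, these functions converge to \<open>0\<close> and to \<open>max 0\<close> along two sequences
  of scales.  The two resulting blow-ups are nested and differ by a set of positive measure in every
  ball, which also separates the densities.
\<close>

section \<open>Haar measures are multiples of Lebesgue measure\<close>

text \<open>One function has to dominate another along \<open>X1\<close> while both stay constant
  along \<open>X2\<close>. Among the degree-3 functions constant along \<open>X2\<close>, the one
  built on \<open>x4\<close> changes along \<open>X1\<close> at the rate \<open>- x1 * x2\<close>,
  the one built on \<open>x5\<close> at the rate \<open>- x2^2 / 2\<close>, and the cube of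
  \<open>x1\<close> supplies the missing \<open>x1^2 / 2\<close>. The domination is then the
  inequality between 2 |x1 x2| and x1^2 + x2^2, and Lipschitz constant 1 is the slope that matches
  it.

  The other difficulty is that the Haar measure and the Carnot distance are arbitrary. The measure
  is reduced to a multiple of Lebesgue measure. For the distance no formula for balls is at hand;
  what is used is that dilations carry balls around 0 to each other, that these balls are open, and
  that the unit ball is bounded. Openness rests on reaching points near 0 by short horizontal
  curves, boundedness on integrating the equations of such curves layer by layer.\<close>

definition scales_lborel :: "real \<Rightarrow> ('a::euclidean_space \<Rightarrow> 'a) \<Rightarrow> bool" where
  "scales_lborel c T \<longleftrightarrow> T \<in> borel_measurable borel \<and>
     (\<forall>F\<in>borel_measurable borel.
        (\<integral>\<^sup>+x. F x \<partial>lborel) = ennreal c * (\<integral>\<^sup>+x. F (T x) \<partial>lborel))"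

lemma scales_lborelD:
  assumes "scales_lborel c T" "F \<in> borel_measurable borel"
  shows "(\<integral>\<^sup>+x. F (T x) \<partial>lborel) * ennreal c = (\<integral>\<^sup>+x. F x \<partial>lborel)"
  using assms by (simp add: scales_lborel_def mult.commute)

lemma scales_lborel_affine:
  fixes c t :: real
  assumes "c \<noteq> 0"
  shows "scales_lborel \<bar>c\<bar> (\<lambda>x. c * x + t)"
  unfolding scales_lborel_def
proof (intro conjI ballI)
  fix F :: "real \<Rightarrow> ennreal" assume "F \<in> borel_measurable borel"
  then show "(\<integral>\<^sup>+x. F x \<partial>lborel) = ennreal \<bar>c\<bar> * (\<integral>\<^sup>+x. F (c * x + t) \<partial>lborel)"
    using nn_integral_real_affine[of F c t] assms by (simp add: add.commute)
qed simp

text \<open>A skew product: the inner map depends on the first coordinate. The outer change of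
  variables is applied to the inner integral as a function of \<open>x\<close>, then the inner one
  for each fixed \<open>x\<close>; this is why \<open>scales_lborel\<close> speaks of nonnegative
  integrals and not of measures of sets. Joint continuity provides the measurability that Fubini's
  theorem asks for.\<close>

lemma scales_lborel_prod:
  fixes T :: "'a::euclidean_space \<Rightarrow> 'a" and S :: "'a \<Rightarrow> 'b::euclidean_space \<Rightarrow> 'b"
  assumes T: "scales_lborel c T" and S: "\<And>x. scales_lborel d (S x)"
    and cont: "continuous_on UNIV (\<lambda>p. (T (fst p), S (fst p) (snd p)))"
    and "0 \<le> c" "0 \<le> d"
  shows "scales_lborel (c * d) (\<lambda>p. (T (fst p), S (fst p) (snd p)))"
proof -
  let ?U = "\<lambda>p. (T (fst p), S (fst p) (snd p))"
  have U: "?U \<in> borel_measurable borel"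
    using cont by (rule borel_measurable_continuous_onI)
  have "(\<integral>\<^sup>+p. F p \<partial>lborel) = ennreal (c * d) * (\<integral>\<^sup>+p. F (?U p) \<partial>lborel)"
    if F: "F \<in> borel_measurable borel" for F :: "'a \<times> 'b \<Rightarrow> ennreal"
  proof -
    have fubini: "(\<integral>\<^sup>+p. H p \<partial>lborel) = (\<integral>\<^sup>+x. \<integral>\<^sup>+y. H (x, y) \<partial>lborel \<partial>lborel)"
      if "H \<in> borel_measurable borel" for H :: "'a \<times> 'b \<Rightarrow> ennreal"
      using that lborel.nn_integral_fst[of H "lborel :: 'a measure"]
      by (simp add: lborel_prod)
    have Fp: "F \<in> borel_measurable (lborel \<Otimes>\<^sub>M lborel)"
      using F by (simp add: lborel_prod)
    have Fx: "(\<lambda>y. F (x, y)) \<in> borel_measurable borel" for x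
      using measurable_Pair2[OF Fp, of x] by simp
    have G: "(\<lambda>x. \<integral>\<^sup>+y. F (x, y) \<partial>lborel) \<in> borel_measurable borel"
      using lborel.borel_measurable_nn_integral_fst[OF Fp] by simp
    have "(\<integral>\<^sup>+p. F p \<partial>lborel) = (\<integral>\<^sup>+x. \<integral>\<^sup>+y. F (x, y) \<partial>lborel \<partial>lborel)"
      using F by (rule fubini)
    also have "\<dots> = ennreal c * (\<integral>\<^sup>+x. \<integral>\<^sup>+y. F (T x, y) \<partial>lborel \<partial>lborel)"
      using T G unfolding scales_lborel_def by blast
    also have "\<dots> = ennreal c * (\<integral>\<^sup>+x. ennreal d * (\<integral>\<^sup>+y. F (T x, S x y) \<partial>lborel) \<partial>lborel)"
    proof -
      have "(\<integral>\<^sup>+y. F (T x, y) \<partial>lborel) = ennreal d * (\<integral>\<^sup>+y. F (T x, S x y) \<partial>lborel)" for x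
        using S[of x] Fx[of "T x"] unfolding scales_lborel_def by blast
      then show ?thesis by simp
    qed
    also have "\<dots> = ennreal c * (ennreal d * (\<integral>\<^sup>+x. \<integral>\<^sup>+y. F (T x, S x y) \<partial>lborel \<partial>lborel))"
    proof -
      have "(\<lambda>p. F (?U p)) \<in> borel_measurable (lborel \<Otimes>\<^sub>M lborel)"
        using measurable_compose[OF U F] by (simp add: lborel_prod)
      from lborel.borel_measurable_nn_integral_fst[OF this]
      have "(\<lambda>x. \<integral>\<^sup>+y. F (T x, S x y) \<partial>lborel) \<in> borel_measurable lborel" by simp
      then show ?thesis by (simp add: nn_integral_cmult)
    qed
    also have "\<dots> = ennreal (c * d) * (\<integral>\<^sup>+p. F (?U p) \<partial>lborel)"
      using fubini[OF measurable_compose[OF U F]] \<open>0 \<le> c\<close> \<open>0 \<le> d\<close>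
      by (simp add: ennreal_mult mult.assoc)
    finally show ?thesis .
  qed
  with U show ?thesis unfolding scales_lborel_def by blast
qed

text \<open>In graded coordinates the group law alters each coordinate by a function of the earlier
  ones, so right translations, dilations and inversion all have this shape, and so does the shear in
  \<open>AE_phi_neq\<close>. The coordinates are treated from the last to the first, with the
  earlier ones as parameters; the Jacobian is the product of the diagonal.\<close>

lemma scales_lborel_triangular:
  fixes s1 s2 s3 s4 s5 t1 :: real and t2 t3 t4 t5
  assumes "s1 \<noteq> 0" "s2 \<noteq> 0" "s3 \<noteq> 0" "s4 \<noteq> 0" "s5 \<noteq> 0"
    and t2: "continuous_on UNIV t2"
    and t3: "continuous_on UNIV (\<lambda>(x1, x2). t3 x1 x2)"
    and t4: "continuous_on UNIV (\<lambda>(x1, x2, x3). t4 x1 x2 x3)"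
    and t5: "continuous_on UNIV (\<lambda>(x1, x2, x3, x4). t5 x1 x2 x3 x4)"
  shows "scales_lborel (\<bar>s1\<bar> * (\<bar>s2\<bar> * (\<bar>s3\<bar> * (\<bar>s4\<bar> * \<bar>s5\<bar>))))
    (\<lambda>(x1, x2, x3, x4, x5). (s1 * x1 + t1, s2 * x2 + t2 x1, s3 * x3 + t3 x1 x2,
       s4 * x4 + t4 x1 x2 x3, s5 * x5 + t5 x1 x2 x3 x4))"
proof -
  have c2: "continuous_on UNIV (\<lambda>x. t2 (f x))" if "continuous_on UNIV f"
    for f :: "'x::topological_space \<Rightarrow> real"
    using continuous_on_compose2[OF t2 that] by simp
  have c3: "continuous_on UNIV (\<lambda>x. t3 (f1 x) (f2 x))"
    if "continuous_on UNIV f1" "continuous_on UNIV f2"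
    for f1 f2 :: "'x::topological_space \<Rightarrow> real"
    using continuous_on_compose2[OF t3, of UNIV "\<lambda>x. (f1 x, f2 x)"] that
    by (simp add: continuous_on_Pair)
  have c4: "continuous_on UNIV (\<lambda>x. t4 (f1 x) (f2 x) (f3 x))"
    if "continuous_on UNIV f1" "continuous_on UNIV f2" "continuous_on UNIV f3"
    for f1 f2 f3 :: "'x::topological_space \<Rightarrow> real"
    using continuous_on_compose2[OF t4, of UNIV "\<lambda>x. (f1 x, f2 x, f3 x)"] that
    by (simp add: continuous_on_Pair)
  have c5: "continuous_on UNIV (\<lambda>x. t5 (f1 x) (f2 x) (f3 x) (f4 x))"
    if "continuous_on UNIV f1" "continuous_on UNIV f2" "continuous_on UNIV f3" "continuous_on UNIV f4"
    for f1 f2 f3 f4 :: "'x::topological_space \<Rightarrow> real"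
    using continuous_on_compose2[OF t5, of UNIV "\<lambda>x. (f1 x, f2 x, f3 x, f4 x)"] that
    by (simp add: continuous_on_Pair)
  note c = c2 c3 c4 c5
  have "scales_lborel (\<bar>s4\<bar> * \<bar>s5\<bar>) (\<lambda>p. (s4 * fst p + t4 x1 x2 x3, s5 * snd p + t5 x1 x2 x3 (fst p)))"
    for x1 x2 x3
    by (rule scales_lborel_prod)
       (use assms in \<open>auto intro!: scales_lborel_affine continuous_intros c\<close>)
  then have "scales_lborel (\<bar>s3\<bar> * (\<bar>s4\<bar> * \<bar>s5\<bar>)) (\<lambda>q. (s3 * fst q + t3 x1 x2,
      (\<lambda>p. (s4 * fst p + t4 x1 x2 (fst q), s5 * snd p + t5 x1 x2 (fst q) (fst p))) (snd q)))"
    for x1 x2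
    by (intro scales_lborel_prod)
       (use assms in \<open>auto intro!: scales_lborel_affine continuous_intros c\<close>)
  then have "scales_lborel (\<bar>s2\<bar> * (\<bar>s3\<bar> * (\<bar>s4\<bar> * \<bar>s5\<bar>))) (\<lambda>r. (s2 * fst r + t2 x1,
      (\<lambda>q. (s3 * fst q + t3 x1 (fst r),
      (\<lambda>p. (s4 * fst p + t4 x1 (fst r) (fst q), s5 * snd p + t5 x1 (fst r) (fst q) (fst p))) (snd q)))
       (snd r)))"
    for x1
    by (intro scales_lborel_prod)
       (use assms in \<open>auto intro!: scales_lborel_affine continuous_intros c\<close>)
  then have "scales_lborel (\<bar>s1\<bar> * (\<bar>s2\<bar> * (\<bar>s3\<bar> * (\<bar>s4\<bar> * \<bar>s5\<bar>)))) (\<lambda>u. (s1 * fst u + t1,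
      (\<lambda>r. (s2 * fst r + t2 (fst u),
      (\<lambda>q. (s3 * fst q + t3 (fst u) (fst r),
      (\<lambda>p. (s4 * fst p + t4 (fst u) (fst r) (fst q), s5 * snd p + t5 (fst u) (fst r) (fst q) (fst p)))
        (snd q))) (snd r))) (snd u)))"
    by (intro scales_lborel_prod)
       (use assms in \<open>auto intro!: scales_lborel_affine continuous_intros c\<close>)
  then show ?thesis
    by (simp add: split_def)
qed

lemma emeasure_vimage_scales_lborel:
  assumes "scales_lborel c T" "A \<in> sets borel"
  shows "emeasure lborel A = ennreal c * emeasure lborel (T -` A)"
proof -
  have T: "T -` A \<in> sets borel"
    using assms measurable_sets[of T borel borel A] by (simp add: scales_lborel_def)
  have "(\<integral>\<^sup>+x. indicator A x \<partial>lborel) = ennreal c * (\<integral>\<^sup>+x. indicator A (T x) \<partial>lborel)"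
    using scales_lborelD[OF assms(1), of "indicator A"] assms(2) by (simp add: mult.commute)
  moreover have "indicator A (T x) = (indicator (T -` A) x :: ennreal)" for x
    by (simp add: indicator_def)
  ultimately show ?thesis using assms T by simp
qed

lemma scales_lborel_right: "scales_lborel 1 (\<lambda>y. y \<odot> x)"
proof -
  obtain a1 a2 a3 a4 a5 where x: "x = (a1, a2, a3, a4, a5)" by (cases x)
  have "scales_lborel (\<bar>1\<bar> * (\<bar>1\<bar> * (\<bar>1\<bar> * (\<bar>1\<bar> * \<bar>1\<bar>))))
    (\<lambda>(y1, y2, y3, y4, y5). (1 * y1 + a1, 1 * y2 + a2, 1 * y3 + (a3 - (a2 * y1 - a1 * y2) / 2),
       1 * y4 + (a4 - (a3 * y1 - a1 * y3) / 2 - (a1 - y1) * (a2 * y1 - a1 * y2) / 12),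
       1 * y5 + (a5 - (a3 * y2 - a2 * y3) / 2 - (a2 - y2) * (a2 * y1 - a1 * y2) / 12)))"
    by (rule scales_lborel_triangular) (auto simp: case_prod_beta intro!: continuous_intros)
  moreover have "(\<lambda>y. y \<odot> x) =
    (\<lambda>(y1, y2, y3, y4, y5). (1 * y1 + a1, 1 * y2 + a2, 1 * y3 + (a3 - (a2 * y1 - a1 * y2) / 2),
       1 * y4 + (a4 - (a3 * y1 - a1 * y3) / 2 - (a1 - y1) * (a2 * y1 - a1 * y2) / 12),
       1 * y5 + (a5 - (a3 * y2 - a2 * y3) / 2 - (a2 - y2) * (a2 * y1 - a1 * y2) / 12)))"
    by (auto simp: fun_eq_iff x f23_mult_def field_simps)
  ultimately show ?thesis by simp
qed

text \<open>The exponent is the homogeneous dimension 1 + 1 + 2 + 3 + 3.\<close>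

lemma scales_lborel_dilation:
  assumes "0 < r"
  shows "scales_lborel (r ^ 10) (dilation r)"
proof -
  have "scales_lborel (\<bar>r\<bar> * (\<bar>r\<bar> * (\<bar>r\<^sup>2\<bar> * (\<bar>r^3\<bar> * \<bar>r^3\<bar>))))
    (\<lambda>(y1, y2, y3, y4, y5). (r * y1 + 0, r * y2 + 0, r\<^sup>2 * y3 + 0, r^3 * y4 + 0, r^3 * y5 + 0))"
    by (rule scales_lborel_triangular) (use assms in \<open>auto simp: case_prod_beta\<close>)
  moreover have "\<bar>r\<bar> * (\<bar>r\<bar> * (\<bar>r\<^sup>2\<bar> * (\<bar>r^3\<bar> * \<bar>r^3\<bar>))) = r ^ 10"
    using assms by (simp add: power2_eq_square power3_eq_cube numeral_eq_Suc)
  moreover have "dilation r =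
    (\<lambda>(y1, y2, y3, y4, y5). (r * y1 + 0, r * y2 + 0, r\<^sup>2 * y3 + 0, r^3 * y4 + 0, r^3 * y5 + 0))"
    by (auto simp: fun_eq_iff)
  ultimately show ?thesis by simp
qed

lemma scales_lborel_uminus: "scales_lborel 1 (f23_inv)"
proof -
  have "scales_lborel (\<bar>-1\<bar> * (\<bar>-1\<bar> * (\<bar>-1\<bar> * (\<bar>-1\<bar> * \<bar>-1\<bar>))))
    (\<lambda>(y1::real, y2::real, y3::real, y4::real, y5::real). (-1 * y1 + 0, -1 * y2 + 0, -1 * y3 + 0, -1 * y4 + 0, -1 * y5 + 0))"
    by (rule scales_lborel_triangular) (auto simp: case_prod_beta)
  moreover have "f23_inv =
    (\<lambda>(y1::real, y2::real, y3::real, y4::real, y5::real). (-1 * y1 + 0, -1 * y2 + 0, -1 * y3 + 0, -1 * y4 + 0, -1 * y5 + 0))"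
    by (auto simp: fun_eq_iff f23_inv_def)
  ultimately show ?thesis by simp
qed

section \<open>Uniqueness of the Haar measure\<close>

interpretation lie_bracket: bounded_bilinear lie_bracket
  using bilinear_lie_bracket by (simp add: bilinear_conv_bounded_bilinear)

lemma continuous_on_f23_mult [continuous_intros]:
  assumes "continuous_on S f" "continuous_on S g"
  shows "continuous_on S (\<lambda>x. f x \<odot> g x)"
  unfolding f23_mult_def using assms by (intro continuous_intros lie_bracket.continuous_on)

lemma f23_inv_mult_cancel [simp]: "f23_inv x \<odot> (x \<odot> y) = y" "x \<odot> (f23_inv x \<odot> y) = y"
  "(y \<odot> x) \<odot> f23_inv x = y" "(y \<odot> f23_inv x) \<odot> x = y"
  by (metis f23.assoc f23.left_inverse f23.right_inverse f23.left_neutral f23.right_neutral)+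

lemma haar_measure_sets:
  assumes "haar_measure M"
  shows "sets M = sets borel" "space M = UNIV"
  using assms sets_eq_imp_space_eq[of M borel] by (auto simp: haar_measure_def)

lemma haar_measure_vimage:
  assumes "haar_measure M" "A \<in> sets borel"
  shows "emeasure M ((\<lambda>y. p \<odot> y) -` A) = emeasure M A"
proof -
  have "(\<lambda>y. p \<odot> y) -` A = (\<lambda>y. f23_inv p \<odot> y) ` A"
    by (force simp: image_iff intro: f23_inv_mult_cancel(1)[symmetric])
  then show ?thesis using assms unfolding haar_measure_def by metis
qed

lemma haar_measure_sigma_finite:
  assumes "haar_measure M"
  shows "sigma_finite_measure M"
proof
  note s = haar_measure_sets(1)[OF assms] and sp = haar_measure_sets(2)[OF assms]
  have "(\<Union>n. cball (0::f23) (real n)) = UNIV"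
    by (auto simp: real_arch_simple)
  then show "\<exists>A. countable A \<and> A \<subseteq> sets M \<and> \<Union> A = space M \<and> (\<forall>a\<in>A. emeasure M a \<noteq> \<infinity>)"
    using assms
    by (intro exI[of _ "range (\<lambda>n. cball (0::f23) (real n))"])
       (auto simp: sp s haar_measure_def less_top)
qed

text \<open>Both sides are the integral of \<open>indicator A x * indicator B (y \<odot> x)\<close> over
  \<open>M \<Otimes>\<^sub>M lborel\<close>, evaluated in the two orders: \<^const>\<open>lborel\<close> is right-invariant and
  invariant under inversion, and \<open>M\<close> is left-invariant.\<close>

lemma haar_measure_unique:
  assumes M: "haar_measure M" and A: "A \<in> sets borel" and B: "B \<in> sets borel"
  shows "emeasure M A * emeasure lborel B = emeasure M B * emeasure lborel A"
proof -
  note s [measurable_cong] = haar_measure_sets(1)[OF M] and sp = haar_measure_sets(2)[OF M]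
  interpret M: sigma_finite_measure M using M by (rule haar_measure_sigma_finite)
  interpret P: pair_sigma_finite M lborel ..
  have mult: "(\<lambda>p. snd p \<odot> fst p) \<in> borel_measurable (borel \<Otimes>\<^sub>M borel :: (f23 \<times> f23) measure)"
    unfolding borel_prod by (intro borel_measurable_continuous_onI continuous_intros)
  have mult': "(\<lambda>p. f23_inv (snd p) \<odot> fst p) \<in> borel_measurable (borel \<Otimes>\<^sub>M borel :: (f23 \<times> f23) measure)"
    unfolding borel_prod f23_inv_def by (intro borel_measurable_continuous_onI continuous_intros)
  have ps: "sets (M \<Otimes>\<^sub>M lborel) = sets (borel \<Otimes>\<^sub>M borel)"
    by (intro sets_pair_measure_cong) (auto simp: s)
  have m1: "(\<lambda>p. indicator A (fst p) * indicator B (snd p \<odot> fst p) :: ennreal)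
      \<in> borel_measurable (M \<Otimes>\<^sub>M lborel)"
    unfolding measurable_cong_sets[OF ps refl]
    using A B measurable_compose[OF mult, of "indicator B :: f23 \<Rightarrow> ennreal"] by measurable
  have m2: "(\<lambda>p. indicator A (f23_inv (snd p) \<odot> fst p) * indicator B (fst p) :: ennreal)
      \<in> borel_measurable (M \<Otimes>\<^sub>M lborel)"
    unfolding measurable_cong_sets[OF ps refl]
    using A B measurable_compose[OF mult', of "indicator A :: f23 \<Rightarrow> ennreal"] by measurable
  have meas: "(\<lambda>x. y \<odot> x) \<in> borel_measurable borel" "(\<lambda>x. x \<odot> y) \<in> borel_measurable borel" for y
    by (intro borel_measurable_continuous_onI continuous_intros)+
  have "emeasure M A * emeasure lborel B = (\<integral>\<^sup>+x. indicator A x * emeasure lborel B \<partial>M)"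
    using A s by (simp add: nn_integral_multc)
  also have "\<dots> = (\<integral>\<^sup>+x. indicator A x * (\<integral>\<^sup>+y. indicator B (y \<odot> x) \<partial>lborel) \<partial>M)"
  proof -
    have "(\<integral>\<^sup>+y. indicator B (y \<odot> x) \<partial>lborel) = (\<integral>\<^sup>+y. indicator B y \<partial>lborel)" for x
      using scales_lborelD[OF scales_lborel_right[of x], of "indicator B"] B by simp
    then show ?thesis using B by simp
  qed
  also have "\<dots> = (\<integral>\<^sup>+x. \<integral>\<^sup>+y. indicator A x * indicator B (y \<odot> x) \<partial>lborel \<partial>M)"
    using B measurable_compose[OF meas(2), of "indicator B :: f23 \<Rightarrow> ennreal"]
    by (simp add: nn_integral_cmult)
  also have "\<dots> = (\<integral>\<^sup>+y. \<integral>\<^sup>+x. indicator A x * indicator B (y \<odot> x) \<partial>M \<partial>lborel)"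
    using P.Fubini[OF m1] lborel.nn_integral_fst[OF m1] by simp
  also have "\<dots> = (\<integral>\<^sup>+y. \<integral>\<^sup>+x. indicator A (f23_inv y \<odot> x) * indicator B x \<partial>M \<partial>lborel)"
  proof (rule nn_integral_cong)
    fix y
    have d: "distr M M (\<lambda>x. y \<odot> x) = M"
    proof (rule measure_eqI)
      fix Q assume "Q \<in> sets (distr M M (\<lambda>x. y \<odot> x))"
      then have "Q \<in> sets borel" by (simp add: s)
      then show "emeasure (distr M M (\<lambda>x. y \<odot> x)) Q = emeasure M Q"
        using meas(1)[of y] haar_measure_vimage[OF M, of Q y]
        by (subst emeasure_distr) (auto simp: s sp cong: measurable_cong_sets)
    qed simp
    have i: "(\<lambda>x. indicator A (f23_inv y \<odot> x) * indicator B x :: ennreal) \<in> borel_measurable M"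
      using A B measurable_compose[OF meas(1), of "indicator A :: f23 \<Rightarrow> ennreal"] by measurable
    have "(\<integral>\<^sup>+x. indicator A (f23_inv y \<odot> x) * indicator B x \<partial>M) =
       (\<integral>\<^sup>+x. indicator A (f23_inv y \<odot> x) * indicator B x \<partial>distr M M (\<lambda>x. y \<odot> x))"
      by (simp add: d)
    also have "\<dots> = (\<integral>\<^sup>+x. indicator A x * indicator B (y \<odot> x) \<partial>M)"
      using meas(1)[of y] i by (subst nn_integral_distr) (auto simp: s cong: measurable_cong_sets)
    finally show "(\<integral>\<^sup>+x. indicator A x * indicator B (y \<odot> x) \<partial>M) =
      (\<integral>\<^sup>+x. indicator A (f23_inv y \<odot> x) * indicator B x \<partial>M)" by simp
  qed
  also have "\<dots> = (\<integral>\<^sup>+x. \<integral>\<^sup>+y. indicator A (f23_inv y \<odot> x) * indicator B x \<partial>lborel \<partial>M)"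
    using P.Fubini[OF m2] lborel.nn_integral_fst[OF m2] by simp
  also have "\<dots> = (\<integral>\<^sup>+x. emeasure lborel A * indicator B x \<partial>M)"
  proof (rule nn_integral_cong)
    fix x
    have c: "(\<lambda>y. f23_inv y \<odot> x) \<in> borel_measurable borel"
      unfolding f23_inv_def by (intro borel_measurable_continuous_onI continuous_intros)
    have "(\<integral>\<^sup>+y. indicator A (f23_inv y \<odot> x) \<partial>lborel) = (\<integral>\<^sup>+y. indicator A (y \<odot> x) \<partial>lborel)"
    proof -
      have "(\<lambda>y. indicator A (y \<odot> x) :: ennreal) \<in> borel_measurable borel"
        using A measurable_compose[OF meas(2), of "indicator A :: f23 \<Rightarrow> ennreal"] by simp
      then show ?thesis
        using scales_lborelD[OF scales_lborel_uminus, of "\<lambda>y. indicator A (y \<odot> x)"] by simp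
    qed
    also have "\<dots> = emeasure lborel A"
      using scales_lborelD[OF scales_lborel_right[of x], of "indicator A"] A by simp
    finally show "(\<integral>\<^sup>+y. indicator A (f23_inv y \<odot> x) * indicator B x \<partial>lborel) = 
      emeasure lborel A * indicator B x"
      using A measurable_compose[OF c, of "indicator A :: f23 \<Rightarrow> ennreal"]
      by (simp add: nn_integral_multc)
  qed
  also have "\<dots> = emeasure M B * emeasure lborel A"
    using B s by (subst nn_integral_cmult) (simp_all add: mult.commute)
  finally show ?thesis .
qed

lemma haar_measure_lborel:
  assumes "haar_measure M"
  obtains c where "0 < c" "c < \<infinity>" "\<And>A. A \<in> sets borel \<Longrightarrow> emeasure M A = c * emeasure lborel A"
proof -
  let ?B = "cbox 0 One :: f23 set"
  have B: "emeasure lborel ?B = 1"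
    by (simp add: emeasure_lborel_cbox)
  have eq: "emeasure M A = emeasure M ?B * emeasure lborel A" if "A \<in> sets borel" for A
    using haar_measure_unique[OF assms that, of ?B] by (simp add: B)
  have "emeasure M UNIV \<noteq> 0" using assms by (simp add: haar_measure_def)
  \<comment> \<open>As 0 times infinity is 0 in \<open>ennreal\<close>, a null unit cube would make
    the whole space null.\<close>
  then have "0 < emeasure M ?B" using eq[of UNIV] by (auto simp: zero_less_iff_neq_zero)
  moreover have "emeasure M ?B < \<infinity>" using assms by (simp add: haar_measure_def)
  ultimately show ?thesis using that eq by blast
qed

section \<open>Carnot balls\<close>

lemma V1_iff: "v \<in> V1 \<longleftrightarrow> (\<exists>a b. v = (a, b, 0, 0, 0))"
proof
  assume "v \<in> V1"
  then obtain a b where "v - a *\<^sub>R X1 = b *\<^sub>R X2"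
    by (auto simp: V1_def span_insert)
  then have "v = a *\<^sub>R X1 + b *\<^sub>R X2"
    by (simp add: algebra_simps)
  then show "\<exists>a b. v = (a, b, 0, 0, 0)"
    by (simp add: X1_def X2_def)
next
  assume "\<exists>a b. v = (a, b, 0, 0, 0)"
  then obtain a b where "v = a *\<^sub>R X1 + b *\<^sub>R X2"
    by (auto simp: X1_def X2_def)
  then show "v \<in> V1"
    by (simp add: V1_def span_add span_base span_scale)
qed

lemma V1_scale: "v \<in> V1 \<Longrightarrow> c *\<^sub>R v \<in> V1"
  by (simp add: V1_def span_scale)

lemma inner_product_scale:
  assumes "inner_product_on V1 g" "v \<in> V1"
  shows "g (c *\<^sub>R v) (c *\<^sub>R v) = c\<^sup>2 * g v v"
proof -
  have "g (c *\<^sub>R v) (c *\<^sub>R v) = c * g v (c *\<^sub>R v)"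
    using assms V1_scale unfolding inner_product_on_def by metis
  also have "g v (c *\<^sub>R v) = c * g v v"
    using assms V1_scale unfolding inner_product_on_def by metis
  finally show ?thesis by (simp add: power2_eq_square)
qed

lemma inner_product_nonneg:
  assumes "inner_product_on V1 g" "v \<in> V1"
  shows "0 \<le> g v v"
proof (cases "v = 0")
  case True
  then show ?thesis using inner_product_scale[OF assms, of 0] by simp
next
  case False
  then show ?thesis using assms unfolding inner_product_on_def by (meson less_imp_le)
qed

text \<open>Completing the square bounds \<open>D * a^2\<close> and \<open>D * b^2\<close> by
  multiples of the quadratic form of \<open>g\<close>, where \<open>D\<close> is its determinant.
  The bound turns the length of a curve into control of its two horizontal velocities.\<close>

lemma inner_product_bound:
  assumes g: "inner_product_on V1 g"
  obtains k where "0 < k"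
    "\<And>a b. \<bar>a\<bar> \<le> k * sqrt (g (a, b, 0, 0, 0) (a, b, 0, 0, 0))"
    "\<And>a b. \<bar>b\<bar> \<le> k * sqrt (g (a, b, 0, 0, 0) (a, b, 0, 0, 0))"
proof -
  define \<alpha> \<beta> \<gamma> where "\<alpha> = g X1 X1" and "\<beta> = g X1 X2" and "\<gamma> = g X2 X2"
  have V: "X1 \<in> V1" "X2 \<in> V1" by (auto simp: V1_def span_base)
  have add: "g (u + v) w = g u w + g v w" if "u \<in> V1" "v \<in> V1" "w \<in> V1" for u v w
    using g that unfolding inner_product_on_def by metis
  have sym: "g u v = g v u" if "u \<in> V1" "v \<in> V1" for u v
    using g that unfolding inner_product_on_def by metis
  have scale: "g (c *\<^sub>R u) v = c * g u v" if "u \<in> V1" "v \<in> V1" for c u v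
    using g that unfolding inner_product_on_def by metis
  have pos: "0 < g u u" if "u \<in> V1" "u \<noteq> 0" for u
    using g that unfolding inner_product_on_def by metis
  have expand: "g (a, b, 0, 0, 0) (a, b, 0, 0, 0) = \<alpha> * a\<^sup>2 + 2 * \<beta> * a * b + \<gamma> * b\<^sup>2" for a b
  proof -
    have v: "(a, b, 0, 0, 0) = a *\<^sub>R X1 + b *\<^sub>R X2" by (simp add: X1_def X2_def)
    have aV: "a *\<^sub>R X1 \<in> V1" "b *\<^sub>R X2 \<in> V1" "a *\<^sub>R X1 + b *\<^sub>R X2 \<in> V1"
      using V by (auto simp: V1_def span_add span_scale)
    have e: "g X (a *\<^sub>R X1 + b *\<^sub>R X2) = a * g X1 X + b * g X2 X" if "X \<in> V1" for X
      using that V aV by (metis add sym scale)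
    show ?thesis unfolding v
      using V aV by (simp add: add scale e sym[of X2 X1] \<alpha>_def \<beta>_def \<gamma>_def power2_eq_square algebra_simps)
  qed
  define D where "D = \<alpha> * \<gamma> - \<beta>\<^sup>2"
  have \<alpha>: "0 < \<alpha>" "0 < \<gamma>"
    using pos V by (auto simp: \<alpha>_def \<gamma>_def X1_def X2_def zero_prod_def)
  \<comment> \<open>This vector is orthogonal to \<open>X2\<close> with respect to \<open>g\<close>.
    Its squared length is \<gamma> times \<open>D\<close>, which turns definiteness into positivity
    of \<open>D\<close>.\<close>
  have "0 < g (\<gamma>, -\<beta>, 0, 0, 0) (\<gamma>, -\<beta>, 0, 0, 0)"
    using \<alpha> by (intro pos) (auto simp: V1_iff zero_prod_def)
  then have "0 < \<gamma> * D"
    by (simp add: expand D_def power2_eq_square algebra_simps)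
  then have D: "0 < D" using \<alpha> by (simp add: zero_less_mult_iff)
  have 1: "\<bar>a\<bar> \<le> sqrt (\<gamma> / D) * sqrt (g (a, b, 0, 0, 0) (a, b, 0, 0, 0))" for a b
  proof -
    have "D * a\<^sup>2 \<le> \<gamma> * (\<alpha> * a\<^sup>2 + 2 * \<beta> * a * b + \<gamma> * b\<^sup>2)"
      using zero_le_power2[of "\<beta> * a + \<gamma> * b"] by (simp add: D_def power2_eq_square algebra_simps)
    then have "a\<^sup>2 \<le> (\<gamma> / D) * g (a, b, 0, 0, 0) (a, b, 0, 0, 0)"
      using D by (simp add: expand field_simps)
    then show ?thesis by (metis real_sqrt_abs real_sqrt_le_iff real_sqrt_mult)
  qed
  have 2: "\<bar>b\<bar> \<le> sqrt (\<alpha> / D) * sqrt (g (a, b, 0, 0, 0) (a, b, 0, 0, 0))" for a b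
  proof -
    have "D * b\<^sup>2 \<le> \<alpha> * (\<alpha> * a\<^sup>2 + 2 * \<beta> * a * b + \<gamma> * b\<^sup>2)"
      using zero_le_power2[of "\<alpha> * a + \<beta> * b"] by (simp add: D_def power2_eq_square algebra_simps)
    then have "b\<^sup>2 \<le> (\<alpha> / D) * g (a, b, 0, 0, 0) (a, b, 0, 0, 0)"
      using D by (simp add: expand field_simps)
    then show ?thesis by (metis real_sqrt_abs real_sqrt_le_iff real_sqrt_mult)
  qed
  have n: "0 \<le> sqrt (g (a, b, 0, 0, 0) (a, b, 0, 0, 0))" for a b
    using inner_product_nonneg[OF g] by (simp add: V1_iff)
  let ?k = "sqrt (\<gamma> / D) + sqrt (\<alpha> / D)"
  show ?thesis
  proof (rule that[of ?k])
    show "0 < ?k" using \<alpha> D by (simp add: add_pos_pos)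
    have "sqrt (\<gamma> / D) \<le> ?k" "sqrt (\<alpha> / D) \<le> ?k" using \<alpha> D by auto
    then show "\<bar>a\<bar> \<le> ?k * sqrt (g (a, b, 0, 0, 0) (a, b, 0, 0, 0))"
      "\<bar>b\<bar> \<le> ?k * sqrt (g (a, b, 0, 0, 0) (a, b, 0, 0, 0))" for a b
      using 1[of a b] 2[of b a] mult_right_mono[OF _ n[of a b]] by (meson order_trans)+
  qed
qed

section \<open>Lengths of horizontal curves from the origin\<close>

definition reach :: "(f23 \<Rightarrow> f23 \<Rightarrow> real) \<Rightarrow> real \<Rightarrow> f23 \<Rightarrow> bool" where
  "reach g L y \<longleftrightarrow> (\<exists>\<gamma> h. horizontal_path \<gamma> h \<and> pathstart \<gamma> = 0 \<and> pathfinish \<gamma> = y \<and>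
     ((\<lambda>t. sqrt (g (h t) (h t))) has_integral L) {0..1})"

text \<open>Lengths of single curves behave exactly under dilation and concatenation, so everything
  below is proved for \<open>reach\<close>; the infimum is met again only in
  \<open>mem_cc_ball\<close>.\<close>

lemma cc_dist_0: "cc_dist g 0 y = Inf {L. reach g L y}"
  unfolding cc_dist_def reach_def
  by (rule arg_cong[where f = Inf]) (auto simp: has_integral_integrable_integral)

lemma reach_nonneg:
  assumes "inner_product_on V1 g" "reach g L y"
  shows "0 \<le> L"
proof -
  obtain \<gamma> h where h: "horizontal_path \<gamma> h" "((\<lambda>t. sqrt (g (h t) (h t))) has_integral L) {0..1}"
    using assms(2) unfolding reach_def by blast
  have "0 \<le> sqrt (g (h t) (h t))" for t
    using h(1) inner_product_nonneg[OF assms(1)] by (simp add: horizontal_path_def)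
  then show ?thesis using has_integral_nonneg[OF h(2)] by simp
qed

text \<open>A line through 0 in exponential coordinates is a one-parameter subgroup: brackets of
  parallel vectors vanish, so its velocity read by left translation is constantly
  \<open>v\<close>.\<close>

lemma reach_V1:
  assumes "v \<in> V1"
  shows "reach g (sqrt (g v v)) v"
proof -
  obtain a b where v: "v = (a, b, 0, 0, 0)" using assms by (auto simp: V1_iff)
  have "left_inv_field v (t *\<^sub>R v) = v" for t
    by (simp add: left_inv_field_eq v)
  moreover have "valid_path (\<lambda>t. t *\<^sub>R v)"
    unfolding valid_path_def
    by (intro C1_differentiable_imp_piecewise) (auto simp: C1_differentiable_on_def
      intro!: exI[of _ "\<lambda>_. v"] derivative_eq_intros)
  moreover have "((\<lambda>t. t *\<^sub>R v) has_vector_derivative v) (at t)" for t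
    by (auto intro!: derivative_eq_intros)
  ultimately have "horizontal_path (\<lambda>t. t *\<^sub>R v) (\<lambda>_. v)"
    using assms by (auto simp: horizontal_path_def)
  then show ?thesis unfolding reach_def
    using has_integral_const_real[of "sqrt (g v v)" 0 1]
    by (intro exI[of _ "\<lambda>t. t *\<^sub>R v"] exI[of _ "\<lambda>_. v"])
       (auto simp: pathstart_def pathfinish_def)
qed

lemma left_inv_field_scale: "left_inv_field (c *\<^sub>R v) p = c *\<^sub>R left_inv_field v p"
  by (simp add: left_inv_field_eq lie_bracket.scaleR_right scaleR_add_right)

lemma left_inv_field_dilation:
  "v \<in> V1 \<Longrightarrow> left_inv_field (r *\<^sub>R v) (dilation r p) = dilation r (left_inv_field v p)"
  by (cases p) (auto simp: V1_iff left_inv_field_eq algebra_simps power2_eq_square power3_eq_cube)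

lemma bounded_linear_dilation: "bounded_linear (dilation r)"
proof -
  have "linear (dilation r)"
    by (auto intro!: linearI simp: algebra_simps)
  then show ?thesis by (simp add: linear_conv_bounded_linear)
qed

lemma valid_path_iff:
  "valid_path \<gamma> \<longleftrightarrow> (\<exists>S D. finite S \<and> continuous_on {0..1} \<gamma> \<and>
     (\<forall>t\<in>{0..1} - S. (\<gamma> has_vector_derivative D t) (at t)) \<and> continuous_on ({0..1} - S) D)"
  unfolding valid_path_def piecewise_C1_differentiable_on_def C1_differentiable_on_def by metis

lemma valid_path_compose_bounded_linear:
  fixes f :: "'a::real_normed_vector \<Rightarrow> 'b::real_normed_vector"
  assumes "valid_path \<gamma>" "bounded_linear f"
  shows "valid_path (\<lambda>t. f (\<gamma> t))"
proof -
  interpret f: bounded_linear f by fact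
  obtain S D where S: "finite S" "continuous_on {0..1} \<gamma>"
    "\<And>t. t \<in> {0..1} - S \<Longrightarrow> (\<gamma> has_vector_derivative D t) (at t)" "continuous_on ({0..1} - S) D"
    using assms unfolding valid_path_iff by metis
  have "((\<lambda>t. f (\<gamma> t)) has_vector_derivative f (D t)) (at t)" if "t \<in> {0..1} - S" for t
    using f.has_vector_derivative[OF S(3)[OF that]] .
  then show ?thesis
    unfolding valid_path_iff using S
    by (intro exI[of _ S] exI[of _ "\<lambda>t. f (D t)"]) (auto intro: f.continuous_on)
qed

lemma reach_dilation:
  assumes g: "inner_product_on V1 g" and "0 < r" "reach g L y"
  shows "reach g (r * L) (dilation r y)"
proof -
  interpret d: bounded_linear "dilation r" by (rule bounded_linear_dilation)
  obtain \<gamma> h S where h: "valid_path \<gamma>" "\<And>t. h t \<in> V1" "finite S"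
     "\<And>t. t\<in>{0..1} - S \<Longrightarrow> (\<gamma> has_vector_derivative left_inv_field (h t) (\<gamma> t)) (at t)"
     "\<gamma> 0 = 0" "\<gamma> 1 = y" "((\<lambda>t. sqrt (g (h t) (h t))) has_integral L) {0..1}"
    using assms(3) unfolding reach_def horizontal_path_def pathstart_def pathfinish_def by blast
  let ?\<gamma> = "\<lambda>t. dilation r (\<gamma> t)" and ?h = "\<lambda>t. r *\<^sub>R h t"
  have "(?\<gamma> has_vector_derivative left_inv_field (?h t) (?\<gamma> t)) (at t)" if "t\<in>{0..1} - S" for t
    using d.has_vector_derivative[OF h(4)[OF that]] h(2) by (simp add: left_inv_field_dilation)
  then have "horizontal_path ?\<gamma> ?h"
    unfolding horizontal_path_def using h V1_scale
      valid_path_compose_bounded_linear[OF h(1) bounded_linear_dilation] by blast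
  moreover have "((\<lambda>t. sqrt (g (?h t) (?h t))) has_integral (r * L)) {0..1}"
    using has_integral_mult_right[OF h(7), of r] \<open>0 < r\<close>
    by (simp add: inner_product_scale[OF g h(2)] real_sqrt_mult)
  ultimately show ?thesis unfolding reach_def
    using h d.zero
    by (intro exI[of _ ?\<gamma>] exI[of _ ?h]) (auto simp: pathstart_def pathfinish_def)
qed

lemma valid_path_left_translation:
  assumes "valid_path \<gamma>"
  shows "valid_path (\<lambda>t. x \<odot> \<gamma> t)"
proof -
  obtain S D where S: "finite S" "continuous_on {0..1} \<gamma>"
    "\<And>t. t \<in> {0..1} - S \<Longrightarrow> (\<gamma> has_vector_derivative D t) (at t)" "continuous_on ({0..1} - S) D"
    using assms unfolding valid_path_iff by metis
  \<comment> \<open>The group product differentiated in its second factor. The last bracket of the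
    BCH formula is quadratic in that factor and contributes two terms.\<close>
  let ?D = "\<lambda>t. D t + (1/2) *\<^sub>R lie_bracket x (D t) + (1/12) *\<^sub>R lie_bracket x (lie_bracket x (D t))
     - (1/12) *\<^sub>R (lie_bracket (\<gamma> t) (lie_bracket x (D t)) + lie_bracket (D t) (lie_bracket x (\<gamma> t)))"
  have "((\<lambda>t. x \<odot> \<gamma> t) has_vector_derivative ?D t) (at t)" if "t \<in> {0..1} - S" for t
  proof -
    note d = S(3)[OF that]
    note b = lie_bracket.has_vector_derivative[OF has_vector_derivative_const d, of x]
    show ?thesis
      unfolding f23_mult_def
      by (rule derivative_eq_intros d b lie_bracket.has_vector_derivative[OF d b]
          lie_bracket.has_vector_derivative[OF has_vector_derivative_const b, of x] refl)+
         (simp add: lie_bracket.zero_left)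
  qed
  moreover have "continuous_on ({0..1} - S) ?D"
    using S(2,4) by (intro continuous_intros lie_bracket.continuous_on) (auto intro: continuous_on_subset)
  moreover have "continuous_on {0..1} (\<lambda>t. x \<odot> \<gamma> t)"
    using S(2) by (intro continuous_intros)
  ultimately show ?thesis
    unfolding valid_path_iff using S(1) by (intro exI[of _ S] exI[of _ ?D]) blast
qed

lemma horizontal_path_left_translation:
  assumes "horizontal_path \<gamma> h"
  shows "horizontal_path (\<lambda>t. x \<odot> \<gamma> t) h"
proof -
  obtain S where h: "valid_path \<gamma>" "\<And>t. h t \<in> V1" "finite S"
     "\<And>t. t\<in>{0..1} - S \<Longrightarrow> (\<gamma> has_vector_derivative left_inv_field (h t) (\<gamma> t)) (at t)"
    using assms unfolding horizontal_path_def by metis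
  have "((\<lambda>t. x \<odot> \<gamma> t) has_vector_derivative left_inv_field (h t) (x \<odot> \<gamma> t)) (at t)"
    if "t\<in>{0..1} - S" for t
  proof -
    note d = h(4)[OF that]
    note b = lie_bracket.has_vector_derivative[OF has_vector_derivative_const d, of x]
    \<comment> \<open>Left invariance of the field, written out as a polynomial identity: the
      right-hand side is the differential at \<open>p\<close> of left translation by
      \<open>x\<close>, applied to the field at \<open>p\<close>.\<close>
    have eq: "left_inv_field v (x \<odot> p) = (let D = left_inv_field v p in
      D + (1/2) *\<^sub>R lie_bracket x D + (1/12) *\<^sub>R lie_bracket x (lie_bracket x D)
     - (1/12) *\<^sub>R (lie_bracket p (lie_bracket x D) + lie_bracket D (lie_bracket x p)))" for v p
      by (cases x; cases p; cases v) (simp add: left_inv_field_eq f23_mult_def Let_def field_simps)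
    show ?thesis
      unfolding f23_mult_def
      by (rule derivative_eq_intros d b lie_bracket.has_vector_derivative[OF d b]
          lie_bracket.has_vector_derivative[OF has_vector_derivative_const b, of x] refl)+
         (simp add: lie_bracket.zero_left eq[unfolded f23_mult_def Let_def])
  qed
  then show ?thesis
    unfolding horizontal_path_def using h(2,3) valid_path_left_translation[OF h(1)] by blast
qed

lemma has_vector_derivative_mult_2:
  fixes t c :: real
  shows "((\<lambda>t. 2 * t) has_vector_derivative 2) (at t)" "((\<lambda>t. 2 * t - c) has_vector_derivative 2) (at t)"
  by (auto intro!: derivative_eq_intros)

lemma horizontal_path_join:
  assumes 1: "horizontal_path \<gamma>1 h1" and 2: "horizontal_path \<gamma>2 h2"
    and j: "pathfinish \<gamma>1 = pathstart \<gamma>2"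
  shows "horizontal_path (\<gamma>1 +++ \<gamma>2)
    (\<lambda>t. if t \<le> 1/2 then 2 *\<^sub>R h1 (2 * t) else 2 *\<^sub>R h2 (2 * t - 1))" (is "horizontal_path _ ?h")
proof -
  obtain S1 where h1: "valid_path \<gamma>1" "\<And>t. h1 t \<in> V1" "finite S1"
     "\<And>t. t\<in>{0..1} - S1 \<Longrightarrow> (\<gamma>1 has_vector_derivative left_inv_field (h1 t) (\<gamma>1 t)) (at t)"
    using 1 unfolding horizontal_path_def by metis
  obtain S2 where h2: "valid_path \<gamma>2" "\<And>t. h2 t \<in> V1" "finite S2"
     "\<And>t. t\<in>{0..1} - S2 \<Longrightarrow> (\<gamma>2 has_vector_derivative left_inv_field (h2 t) (\<gamma>2 t)) (at t)"
    using 2 unfolding horizontal_path_def by metis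
  \<comment> \<open>The junction, and the exceptional times of both curves moved to the half
    intervals in which the curves are run through.\<close>
  let ?S = "insert (1/2) ((\<lambda>s. s / 2) ` S1 \<union> (\<lambda>s. (s + 1) / 2) ` S2)"
  have "((\<gamma>1 +++ \<gamma>2) has_vector_derivative left_inv_field (?h t) ((\<gamma>1 +++ \<gamma>2) t)) (at t)"
    if t: "t \<in> {0..1} - ?S" for t
  proof (cases "t < 1/2")
    case True
    have "2 * t \<notin> S1" using t imageI[of "2 * t" S1 "\<lambda>s. s / 2"] by auto
    then have "(\<gamma>1 has_vector_derivative left_inv_field (h1 (2*t)) (\<gamma>1 (2*t))) (at (2*t))"
      using h1(4) t True by auto
    from vector_diff_chain_at[where f = "\<lambda>t. 2 * t" and f' = 2 and x = t, OF _ this]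
    have "((\<lambda>t. \<gamma>1 (2 * t)) has_vector_derivative left_inv_field (?h t) (\<gamma>1 (2*t))) (at t)"
      using True by (simp add: left_inv_field_scale o_def has_vector_derivative_mult_2)
    then have "((\<gamma>1 +++ \<gamma>2) has_vector_derivative left_inv_field (?h t) (\<gamma>1 (2*t))) (at t)"
      by (rule has_vector_derivative_transform_within_open[where S = "{..<1/2}"])
         (use True in \<open>auto simp: joinpaths_def\<close>)
    then show ?thesis using True by (simp add: joinpaths_def)
  next
    case False
    with t have t2: "t > 1/2" by auto
    have "2 * t - 1 \<notin> S2" using t imageI[of "2 * t - 1" S2 "\<lambda>s. (s + 1) / 2"] by auto
    then have "(\<gamma>2 has_vector_derivative left_inv_field (h2 (2*t - 1)) (\<gamma>2 (2*t - 1))) (at (2*t - 1))"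
      using h2(4) t t2 by auto
    from vector_diff_chain_at[where f = "\<lambda>t. 2 * t - 1" and f' = 2 and x = t, OF _ this]
    have "((\<lambda>t. \<gamma>2 (2 * t - 1)) has_vector_derivative left_inv_field (?h t) (\<gamma>2 (2*t - 1))) (at t)"
      using t2 by (simp add: left_inv_field_scale o_def has_vector_derivative_mult_2)
    then have "((\<gamma>1 +++ \<gamma>2) has_vector_derivative left_inv_field (?h t) (\<gamma>2 (2*t - 1))) (at t)"
      by (rule has_vector_derivative_transform_within_open[where S = "{1/2<..}"])
         (use t2 in \<open>auto simp: joinpaths_def\<close>)
    then show ?thesis using t2 by (simp add: joinpaths_def)
  qed
  moreover have "valid_path (\<gamma>1 +++ \<gamma>2)"
    using h1(1) h2(1) j by (rule valid_path_join)
  moreover have "finite ?S" using h1(3) h2(3) by simp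
  moreover have "?h t \<in> V1" for t using h1(2) h2(2) V1_scale by simp
  ultimately show ?thesis unfolding horizontal_path_def by blast
qed

lemma has_integral_join_speed:
  fixes f1 f2 :: "real \<Rightarrow> real"
  assumes "(f1 has_integral a) {0..1}" "(f2 has_integral b) {0..1}"
  shows "((\<lambda>t. if t \<le> 1/2 then 2 * f1 (2 * t) else 2 * f2 (2 * t - 1)) has_integral (a + b)) {0..1}"
proof -
  let ?f = "\<lambda>t. if t \<le> 1/2 then 2 * f1 (2 * t) else 2 * f2 (2 * t - 1)"
  have 1: "((\<lambda>t. 2 * f1 (2 * t)) has_integral a) {0..1/2}"
    using has_integral_mult_right[OF has_integral_affinity'[of f1 a 0 1 2 0], of 2] assms(1) by simp
  have "(?f has_integral a) {0..1/2}"
    by (rule has_integral_eq[OF _ 1]) simp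
  moreover have 2: "((\<lambda>t. 2 * f2 (2 * t - 1)) has_integral b) {1/2..1}"
    using has_integral_mult_right[OF has_integral_affinity'[of f2 b 0 1 2 "-1"], of 2] assms(2) by simp
  \<comment> \<open>At time \<open>1/2\<close> the first branch applies, so on the second half the
    two functions agree only off that point.\<close>
  have "(?f has_integral b) {1/2..1}"
    by (rule has_integral_spike[OF negligible_sing[of "1/2"] _ 2]) auto
  ultimately show ?thesis
    by (intro has_integral_combine[of 0 "1/2"]) auto
qed

text \<open>The triangle inequality in group form: the second curve is translated by
  \<open>x\<close> on the left, which keeps its horizontal velocity and hence its length, and
  continues the first.\<close>

lemma reach_mult:
  assumes g: "inner_product_on V1 g" and 1: "reach g a x" and 2: "reach g b y"
  shows "reach g (a + b) (x \<odot> y)"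
proof -
  obtain \<gamma>1 h1 where h1: "horizontal_path \<gamma>1 h1" "pathstart \<gamma>1 = 0" "pathfinish \<gamma>1 = x"
     "((\<lambda>t. sqrt (g (h1 t) (h1 t))) has_integral a) {0..1}"
    using 1 unfolding reach_def by metis
  obtain \<gamma>2 h2 where h2: "horizontal_path \<gamma>2 h2" "pathstart \<gamma>2 = 0" "pathfinish \<gamma>2 = y"
     "((\<lambda>t. sqrt (g (h2 t) (h2 t))) has_integral b) {0..1}"
    using 2 unfolding reach_def by metis
  let ?h = "\<lambda>t. if t \<le> 1/2 then 2 *\<^sub>R h1 (2 * t) else 2 *\<^sub>R h2 (2 * t - 1)"
  let ?\<gamma> = "\<gamma>1 +++ (\<lambda>t. x \<odot> \<gamma>2 t)"
  have V: "h1 t \<in> V1" "h2 t \<in> V1" for t using h1 h2 unfolding horizontal_path_def by auto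
  have "horizontal_path ?\<gamma> ?h"
    using h1 h2 by (intro horizontal_path_join horizontal_path_left_translation)
      (auto simp: pathstart_def)
  moreover have "pathstart ?\<gamma> = 0" "pathfinish ?\<gamma> = x \<odot> y"
    using h1 h2 by (auto simp: pathfinish_def pathstart_def joinpaths_def)
  moreover have "((\<lambda>t. sqrt (g (?h t) (?h t))) has_integral (a + b)) {0..1}"
    by (rule has_integral_eq[OF _ has_integral_join_speed[OF h1(4) h2(4)]])
       (simp add: inner_product_scale[OF g] V real_sqrt_mult)
  ultimately show ?thesis unfolding reach_def by blast
qed

section \<open>A priori bounds for horizontal curves of length at most 1\<close>

lemma left_inv_field_V1:
  "left_inv_field (a, b, 0, 0, 0) (x1, x2, x3, x4, x5) = (a, b, (x2 * a - x1 * b) / 2,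
     x3 * a / 2 - x1 * (x2 * a - x1 * b) / 12, x3 * b / 2 - x2 * (x2 * a - x1 * b) / 12)"
  by (simp add: left_inv_field_eq field_simps)

text \<open>\<open>N\<close> plays the role of the speed of a curve of length \<open>L\<close>. A
  coordinate whose derivative is at most \<open>C\<close> times the speed moves by at most
  \<open>C * L\<close>.\<close>

lemma abs_bound_of_derivative_bound:
  fixes f f' N :: "real \<Rightarrow> real"
  assumes "continuous_on {0..1} f" "finite S" "f 0 = 0"
    and f': "\<And>t. t \<in> {0..1} - S \<Longrightarrow> (f has_vector_derivative f' t) (at t)"
    and bound: "\<And>t. t \<in> {0..1} \<Longrightarrow> \<bar>f' t\<bar> \<le> C * N t"
    and N: "(N has_integral L) {0..1}" "\<And>t. 0 \<le> N t" and "L \<le> 1" "0 \<le> C"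
    and t: "t \<in> {0..1}"
  shows "\<bar>f t\<bar> \<le> C"
proof -
  have "(f' has_integral (f t - f 0)) {0..t}"
    using assms by (intro fundamental_theorem_of_calculus_interior_strong[of S])
      (auto intro: continuous_on_subset)
  then have f: "(f' has_integral f t) {0..t}" using \<open>f 0 = 0\<close> by simp
  have N1: "N integrable_on {0..1}" using N(1) by blast
  have Nt: "N integrable_on {0..t}"
    by (rule integrable_subinterval_real[OF N1]) (use t in auto)
  have "norm (f t) \<le> integral {0..t} (\<lambda>s. C * N s)"
    unfolding integral_unique[OF f, symmetric] using f Nt bound t
    by (intro integral_norm_bound_integral integrable_on_mult_right) auto
  also have "\<dots> = C * integral {0..t} N" by simp
  also have "integral {0..t} N \<le> integral {0..1} N"
    using t N(2) Nt N1 by (intro integral_subset_le) auto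
  also have "\<dots> \<le> 1" using N(1) \<open>L \<le> 1\<close> by (simp add: integral_unique)
  finally show ?thesis using \<open>0 \<le> C\<close> by (simp add: mult_left_mono)
qed

text \<open>The equations of a horizontal curve are triangular: the derivative of a coordinate
  involves only the velocities and coordinates of lower layers. Bounds therefore pass from layer to
  layer, giving \<open>k\<close>, then \<open>k^2\<close>, then \<open>k^3\<close>, with no Gronwall
  argument.\<close>

lemma reach_bounded:
  assumes g: "inner_product_on V1 g"
  obtains R where "\<And>L y. reach g L y \<Longrightarrow> L \<le> 1 \<Longrightarrow> norm y \<le> R"
proof -
  obtain k where k: "0 < k"
    "\<And>a b. \<bar>a\<bar> \<le> k * sqrt (g (a, b, 0, 0, 0) (a, b, 0, 0, 0))"
    "\<And>a b. \<bar>b\<bar> \<le> k * sqrt (g (a, b, 0, 0, 0) (a, b, 0, 0, 0))"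
    using inner_product_bound[OF g] by metis
  have "norm y \<le> k + (k + (k^2 + (k^3 + k^3)))" if r: "reach g L y" and L: "L \<le> 1" for L y
  proof -
    obtain \<gamma> h S where h: "valid_path \<gamma>" "\<And>t. h t \<in> V1" "finite S"
       "\<And>t. t\<in>{0..1} - S \<Longrightarrow> (\<gamma> has_vector_derivative left_inv_field (h t) (\<gamma> t)) (at t)"
       "\<gamma> 0 = 0" "\<gamma> 1 = y" "((\<lambda>t. sqrt (g (h t) (h t))) has_integral L) {0..1}"
      using r unfolding reach_def horizontal_path_def pathstart_def pathfinish_def by blast
    have "\<exists>a b. \<forall>t. h t = (a t, b t, 0, 0, 0)" using h(2) unfolding V1_iff by metis
    then obtain a b where ab: "\<And>t. h t = (a t, b t, 0, 0, 0)" by blast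
    define N where "N t = sqrt (g (h t) (h t))" for t
    have N: "0 \<le> N t" "\<bar>a t\<bar> \<le> k * N t" "\<bar>b t\<bar> \<le> k * N t" for t
      using inner_product_nonneg[OF g h(2)] k(2,3) by (auto simp: N_def ab)
    have NL: "(N has_integral L) {0..1}" using h(7) by (simp add: N_def[abs_def])
    define x1 where "x1 t = fst (\<gamma> t)" for t
    define x2 where "x2 t = fst (snd (\<gamma> t))" for t
    define x3 where "x3 t = fst (snd (snd (\<gamma> t)))" for t
    define x4 where "x4 t = fst (snd (snd (snd (\<gamma> t))))" for t
    define x5 where "x5 t = snd (snd (snd (snd (\<gamma> t))))" for t
    note x_defs = x1_def x2_def x3_def x4_def x5_def
    have \<gamma>: "\<gamma> t = (x1 t, x2 t, x3 t, x4 t, x5 t)" for t by (simp add: x_defs)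
    have cont: "continuous_on {0..1} \<gamma>" using h(1) valid_path_iff by blast
    have "continuous_on {0..1} x1" "continuous_on {0..1} x2" "continuous_on {0..1} x3"
      "continuous_on {0..1} x4" "continuous_on {0..1} x5"
      unfolding x_defs using cont by (intro continuous_intros; simp)+
    note C = this
    have zero: "x1 0 = 0" "x2 0 = 0" "x3 0 = 0" "x4 0 = 0" "x5 0 = 0"
      using h(5) by (auto simp: x_defs)
    define d3 where "d3 t = (x2 t * a t - x1 t * b t) / 2" for t
    define d4 where "d4 t = x3 t * a t / 2 - x1 t * (x2 t * a t - x1 t * b t) / 12" for t
    define d5 where "d5 t = x3 t * b t / 2 - x2 t * (x2 t * a t - x1 t * b t) / 12" for t
    have d: "(\<gamma> has_vector_derivative (a t, b t, d3 t, d4 t, d5 t)) (at t)" if "t\<in>{0..1} - S" for t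
      using h(4)[OF that] by (simp add: ab \<gamma>[of t] left_inv_field_V1 d3_def d4_def d5_def)
    note fst' = bounded_linear.has_vector_derivative[OF bounded_linear_fst]
    note snd' = bounded_linear.has_vector_derivative[OF bounded_linear_snd]
    have dx: "(x1 has_vector_derivative a t) (at t)" "(x2 has_vector_derivative b t) (at t)"
      "(x3 has_vector_derivative d3 t) (at t)" "(x4 has_vector_derivative d4 t) (at t)"
      "(x5 has_vector_derivative d5 t) (at t)" if "t\<in>{0..1} - S" for t
      unfolding x_defs using fst'[OF d[OF that]] fst'[OF snd'[OF d[OF that]]]
        fst'[OF snd'[OF snd'[OF d[OF that]]]] fst'[OF snd'[OF snd'[OF snd'[OF d[OF that]]]]]
        snd'[OF snd'[OF snd'[OF snd'[OF d[OF that]]]]] by simp_all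
    note bd = abs_bound_of_derivative_bound[OF _ h(3) _ _ _ NL N(1) L]
    have 1: "\<bar>x1 t\<bar> \<le> k" "\<bar>x2 t\<bar> \<le> k" if "t \<in> {0..1}" for t
      using bd[OF C(1) zero(1) dx(1) N(2) _ that] bd[OF C(2) zero(2) dx(2) N(3) _ that] k(1) by auto
    have k3: "k^2 * (k * N t) = k^3 * N t" "k * (2 * (k^2 * N t)) = 2 * (k^3 * N t)" for t
      by (simp_all add: power2_eq_square power3_eq_cube)
    have prod: "\<bar>x * y\<bar> \<le> X * Y" if "\<bar>x\<bar> \<le> X" "\<bar>y\<bar> \<le> Y" for x y X Y :: real
      using that by (metis abs_ge_zero abs_mult mult_mono' )
    have d3: "\<bar>d3 t\<bar> \<le> k^2 * N t" if "t \<in> {0..1}" for t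
      using prod[OF 1(2)[OF that] N(2)[of t]] prod[OF 1(1)[OF that] N(3)[of t]]
      by (simp add: d3_def power2_eq_square mult.assoc)
    have 3: "\<bar>x3 t\<bar> \<le> k^2" if "t \<in> {0..1}" for t
      using bd[OF C(3) zero(3) dx(3) d3 _ that] by auto
    have d3': "\<bar>x2 t * a t - x1 t * b t\<bar> \<le> 2 * (k^2 * N t)" if "t \<in> {0..1}" for t
      using d3[OF that] by (simp add: d3_def)
    have half: "\<bar>A / 2 - B / 12\<bar> \<le> Q" if "\<bar>A\<bar> \<le> Q" "\<bar>B\<bar> \<le> 2 * Q" for A B Q :: real
      using that by linarith
    have d4: "\<bar>d4 t\<bar> \<le> k^3 * N t" if "t \<in> {0..1}" for t
      using prod[OF 3[OF that] N(2)[of t]] prod[OF 1(1)[OF that] d3'[OF that]]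
      unfolding d4_def k3 by (rule half)
    have d5: "\<bar>d5 t\<bar> \<le> k^3 * N t" if "t \<in> {0..1}" for t
      using prod[OF 3[OF that] N(3)[of t]] prod[OF 1(2)[OF that] d3'[OF that]]
      unfolding d5_def k3 by (rule half)
    have 4: "\<bar>x4 t\<bar> \<le> k^3" "\<bar>x5 t\<bar> \<le> k^3" if "t \<in> {0..1}" for t
      using bd[OF C(4) zero(4) dx(4) d4 _ that] bd[OF C(5) zero(5) dx(5) d5 _ that] k(1) by auto
    have "norm y \<le> norm (x1 1) + (norm (x2 1) + (norm (x3 1) + (norm (x4 1) + norm (x5 1))))"
      unfolding h(6)[symmetric] \<gamma> by (meson norm_Pair_le add_left_mono order_trans)
    then show ?thesis using 1[of 1] 3[of 1] 4[of 1] by simp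
  qed
  then show ?thesis using that by blast
qed

section \<open>Connectivity by horizontal curves through commutators\<close>

definition commutator :: "f23 \<Rightarrow> f23 \<Rightarrow> f23" where
  "commutator x y = x \<odot> y \<odot> (- x) \<odot> (- y)"

text \<open>A commutator contains each factor with both signs, so nesting commutators calls for a
  bound that covers the inverse as well.\<close>

definition reach_sym :: "(f23 \<Rightarrow> f23 \<Rightarrow> real) \<Rightarrow> real \<Rightarrow> f23 \<Rightarrow> bool" where
  "reach_sym g L y \<longleftrightarrow> reach g L y \<and> reach g L (- y)"

text \<open>The inverse of a commutator is the commutator with the factors exchanged, a word of the
  same length.\<close>

lemma reach_sym_commutator:
  assumes g: "inner_product_on V1 g" and "reach_sym g a x" "reach_sym g b y"
  shows "reach_sym g (2 * a + 2 * b) (commutator x y)"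
proof -
  have "reach g (a + b + a + b) (commutator x y)" "reach g (b + a + b + a) (commutator y x)"
    unfolding commutator_def using assms unfolding reach_sym_def by (intro reach_mult; blast)+
  moreover have "- commutator x y = commutator y x"
    by (cases x; cases y) (simp add: commutator_def f23_mult_def field_simps)
  moreover have "a + b + a + b = 2 * a + 2 * b" "b + a + b + a = 2 * a + 2 * b" by simp_all
  ultimately show ?thesis unfolding reach_sym_def by metis
qed

lemma reach_sym_V1:
  assumes g: "inner_product_on V1 g" and "v \<in> V1"
  shows "reach_sym g (\<bar>s\<bar> * sqrt (g v v)) (s *\<^sub>R v)"
proof -
  have "reach g (sqrt (g (s *\<^sub>R v) (s *\<^sub>R v))) (s *\<^sub>R v)" for s
    using assms V1_scale by (intro reach_V1) blast
  from this[of s] this[of "- s"] show ?thesis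
    by (simp add: reach_sym_def inner_product_scale[OF assms] real_sqrt_mult)
       (simp add: inner_product_scale[OF assms, of "-s", simplified] real_sqrt_mult)
qed

text \<open>The numbers \<open>z4\<close> and \<open>z5\<close> absorb the third-layer terms of the first three factors.\<close>

lemma f23_eq_product:
  fixes y1 y2 y3 y4 y5 :: real
  defines "z3 \<equiv> y3 + y1 * y2 / 2"
  defines "z4 \<equiv> y4 - y1\<^sup>2 * y2 / 12 + z3 / 2 + y1 * z3 / 2"
  defines "z5 \<equiv> y5 + y1 * y2\<^sup>2 / 12 + z3\<^sup>2 / 2 + y2 * z3 / 2"
  shows "(y1, y2, y3, y4, y5) = (y1 *\<^sub>R X1) \<odot> (y2 *\<^sub>R X2) \<odot> commutator (z3 *\<^sub>R X2) (1 *\<^sub>R X1)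
    \<odot> commutator (commutator (1 *\<^sub>R X2) (1 *\<^sub>R X1)) (z4 *\<^sub>R X1)
    \<odot> commutator (commutator (1 *\<^sub>R X2) (1 *\<^sub>R X1)) (z5 *\<^sub>R X2)"
proof -
  have 1: "(y1 *\<^sub>R X1) \<odot> (y2 *\<^sub>R X2) = (y1, y2, - y1 * y2 / 2, y1\<^sup>2 * y2 / 12, - y1 * y2\<^sup>2 / 12)"
    by (simp add: X1_def X2_def f23_mult_def power2_eq_square field_simps)
  have 2: "commutator (z *\<^sub>R X2) (1 *\<^sub>R X1) = (0, 0, z, - z / 2, - z\<^sup>2 / 2)" for z
    by (simp add: X1_def X2_def f23_mult_def commutator_def power2_eq_square field_simps)
  \<comment> \<open>The third layer is central, so \<open>p\<close> and \<open>q\<close> are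
    arbitrary: nested commutators give pure third-layer elements.\<close>
  have 3: "commutator (0, 0, 1, p, q) (z *\<^sub>R X1) = (0, 0, 0, z, 0)"
    "commutator (0, 0, 1, p, q) (z *\<^sub>R X2) = (0, 0, 0, 0, z)" for z p q :: real
    by (simp_all add: X1_def X2_def f23_mult_def commutator_def field_simps)
  show ?thesis
    unfolding 1 2 3 by (simp add: f23_mult_def z4_def z5_def) (simp add: z3_def field_simps)
qed

text \<open>A quantitative Chow theorem. Every element is an explicit word in multiples of
  \<open>X1\<close> and \<open>X2\<close>, and the length of the word is bounded as long as the
  coordinates are.\<close>

lemma reach_near_0:
  assumes g: "inner_product_on V1 g"
  obtains K where "0 < K" "\<And>y. norm y \<le> 1 \<Longrightarrow> \<exists>L\<le>K. reach g L y"
    and "\<And>y. \<exists>L. reach g L y"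
proof -
  define \<kappa> where "\<kappa> = 1 + sqrt (g X1 X1) + sqrt (g X2 X2)"
  have V: "X1 \<in> V1" "X2 \<in> V1" by (auto simp: V1_def span_base)
  note s = reach_sym_V1[OF g V(1)] reach_sym_V1[OF g V(2)]
  have n: "0 \<le> sqrt (g X1 X1)" "0 \<le> sqrt (g X2 X2)"
    using inner_product_nonneg[OF g] V by auto
  let ?a = "sqrt (g X1 X1)" and ?b = "sqrt (g X2 X2)"
  have word: "reach g (\<bar>y1\<bar> * ?a + \<bar>y2\<bar> * ?b + (2 * (\<bar>z3\<bar> * ?b) + 2 * (\<bar>1\<bar> * ?a))
      + (2 * (2 * (\<bar>1\<bar> * ?b) + 2 * (\<bar>1\<bar> * ?a)) + 2 * (\<bar>z4\<bar> * ?a))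
      + (2 * (2 * (\<bar>1\<bar> * ?b) + 2 * (\<bar>1\<bar> * ?a)) + 2 * (\<bar>z5\<bar> * ?b))) (y1, y2, y3, y4, y5)"
    if "z3 = y3 + y1 * y2 / 2" "z4 = y4 - y1\<^sup>2 * y2 / 12 + z3 / 2 + y1 * z3 / 2"
      "z5 = y5 + y1 * y2\<^sup>2 / 12 + z3\<^sup>2 / 2 + y2 * z3 / 2" for y1 y2 y3 y4 y5 z3 z4 z5 :: real
  proof -
    have *: "(y1, y2, y3, y4, y5) = (y1 *\<^sub>R X1) \<odot> (y2 *\<^sub>R X2) \<odot> commutator (z3 *\<^sub>R X2) (1 *\<^sub>R X1)
      \<odot> commutator (commutator (1 *\<^sub>R X2) (1 *\<^sub>R X1)) (z4 *\<^sub>R X1)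
      \<odot> commutator (commutator (1 *\<^sub>R X2) (1 *\<^sub>R X1)) (z5 *\<^sub>R X2)"
      unfolding that by (rule f23_eq_product)
    have r: "reach g L y" if "reach_sym g L y" for L y
      using that by (simp add: reach_sym_def)
    show ?thesis
      unfolding * by (intro reach_mult[OF g] r reach_sym_commutator[OF g] s)
  qed
  \<comment> \<open>For coordinates of modulus at most 1 the word costs at most
    \<open>19 * ?a + 23 * ?b\<close>, and 42 = 19 + 23 generously covers both coefficients. The
    summand 1 in \<kappa> makes the bound positive.\<close>
  have "\<exists>L\<le>42 * \<kappa>. reach g L y" if "norm y \<le> 1" for y
  proof -
    obtain y1 y2 y3 y4 y5 where y: "y = (y1, y2, y3, y4, y5)" by (cases y)
    have n1: "norm (y1, y2, y3, y4, y5) \<le> 1" using that by (simp add: y)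
    note n2 = order_trans[OF norm_snd_le n1]
    note n3 = order_trans[OF norm_snd_le n2]
    note n4 = order_trans[OF norm_snd_le n3]
    have "norm y1 \<le> 1" "norm y2 \<le> 1" "norm y3 \<le> 1" "norm y4 \<le> 1" "norm y5 \<le> 1"
      using order_trans[OF norm_fst_le n1] order_trans[OF norm_fst_le n2] order_trans[OF norm_fst_le n3]
        order_trans[OF norm_fst_le n4] order_trans[OF norm_snd_le n4] .
    then have b: "\<bar>y1\<bar> \<le> 1" "\<bar>y2\<bar> \<le> 1" "\<bar>y3\<bar> \<le> 1" "\<bar>y4\<bar> \<le> 1" "\<bar>y5\<bar> \<le> 1" by simp_all
    define z3 where "z3 = y3 + y1 * y2 / 2"
    define z4 where "z4 = y4 - y1\<^sup>2 * y2 / 12 + z3 / 2 + y1 * z3 / 2"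
    define z5 where "z5 = y5 + y1 * y2\<^sup>2 / 12 + z3\<^sup>2 / 2 + y2 * z3 / 2"
    have prod: "\<bar>x * y\<bar> \<le> X * Y" if "\<bar>x\<bar> \<le> X" "\<bar>y\<bar> \<le> Y" for x y X Y :: real
      using that by (metis abs_ge_zero abs_mult mult_mono')
    have z3: "\<bar>z3\<bar> \<le> 2" using prod[OF b(1) b(2)] b unfolding z3_def by linarith
    have q: "\<bar>y1\<^sup>2\<bar> \<le> 1 * 1" "\<bar>y2\<^sup>2\<bar> \<le> 1 * 1" "\<bar>z3\<^sup>2\<bar> \<le> 2 * 2" unfolding power2_eq_square
      using prod[OF b(1) b(1)] prod[OF b(2) b(2)] prod[OF z3 z3] by blast+
    have z4: "\<bar>z4\<bar> \<le> 4" using prod[OF q(1) b(2)] prod[OF b(1) z3] b z3 unfolding z4_def by linarith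
    have z5: "\<bar>z5\<bar> \<le> 5" using prod[OF b(1) q(2)] prod[OF b(2) z3] b q(3) unfolding z5_def by linarith
    have sum_le: "p1 + p2 + (2 * p3 + 2 * (\<bar>1\<bar> * a)) + (2 * (2 * (\<bar>1\<bar> * b) + 2 * (\<bar>1\<bar> * a)) + 2 * p4)
        + (2 * (2 * (\<bar>1\<bar> * b) + 2 * (\<bar>1\<bar> * a)) + 2 * p5) \<le> 42 * (1 + a + b)"
      if "p1 \<le> 1 * a" "p2 \<le> 1 * b" "p3 \<le> 2 * b" "p4 \<le> 4 * a" "p5 \<le> 5 * b" "0 \<le> a" "0 \<le> b"
      for p1 p2 p3 p4 p5 a b :: real
      using that by simp
    have m: "\<bar>u\<bar> * ?a \<le> U * ?a" "\<bar>u\<bar> * ?b \<le> U * ?b" if "\<bar>u\<bar> \<le> U" for u U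
      using that n by (auto intro: mult_right_mono)
    show ?thesis
      unfolding y
      by (rule exI, rule conjI[OF _ word[OF z3_def z4_def z5_def]], unfold \<kappa>_def)
         (rule sum_le[OF m(1)[OF b(1)] m(2)[OF b(2)] m(2)[OF z3] m(1)[OF z4] m(2)[OF z5] n])
  qed
  moreover have "\<exists>L. reach g L y" for y
    by (cases y) (use word[OF refl refl refl] in blast)
  moreover have "0 < 42 * \<kappa>" 
    using add_pos_nonneg[OF add_pos_nonneg[OF zero_less_one n(1)] n(2)] by (simp add: \<kappa>_def)
  ultimately show ?thesis using that by blast
qed

section \<open>Homogeneity and topology of the balls\<close>

lemma dilation_dilation: "dilation r (dilation s y) = dilation (r * s) y"
  by (cases y) (simp add: power_mult_distrib)

lemma dilation_1 [simp]: "dilation 1 y = y"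
  by (cases y) simp

lemma continuous_on_dilation [continuous_intros]:
  "continuous_on S f \<Longrightarrow> continuous_on S (\<lambda>x. dilation r (f x))"
  using bounded_linear.continuous_on[OF bounded_linear_dilation] .

definition cc_ball :: "(f23 \<Rightarrow> f23 \<Rightarrow> real) \<Rightarrow> real \<Rightarrow> f23 set" where
  "cc_ball g r = {y. cc_dist g 0 y < r}"

text \<open>\<open>Inf\<close> on the reals is meaningful for nonempty sets that are bounded below;
  connectivity gives the first property and nonnegative lengths the second.\<close>

lemma mem_cc_ball:
  assumes g: "inner_product_on V1 g"
  shows "y \<in> cc_ball g r \<longleftrightarrow> (\<exists>L<r. reach g L y)"
proof -
  have "{L. reach g L y} \<noteq> {}" using reach_near_0[OF g] by (metis Collect_empty_eq)
  moreover have "bdd_below {L. reach g L y}" 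
    using reach_nonneg[OF g, of _ y] by (intro bdd_belowI[of _ 0]) blast
  ultimately show ?thesis by (simp add: cc_ball_def cc_dist_0 cInf_less_iff) blast
qed

lemma cc_ball_dilation:
  assumes g: "inner_product_on V1 g" and "0 < r"
  shows "dilation r y \<in> cc_ball g (r * s) \<longleftrightarrow> y \<in> cc_ball g s"
proof
  assume "y \<in> cc_ball g s"
  then obtain L where "L < s" "reach g L y" unfolding mem_cc_ball[OF g] by blast
  then show "dilation r y \<in> cc_ball g (r * s)"
    unfolding mem_cc_ball[OF g] using reach_dilation[OF g \<open>0 < r\<close>, of L y] \<open>0 < r\<close>
    by (intro exI[of _ "r * L"]) simp
next
  assume "dilation r y \<in> cc_ball g (r * s)"
  then obtain L where L: "L < r * s" "reach g L (dilation r y)"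
    unfolding mem_cc_ball[OF g] by blast
  have "reach g ((1/r) * L) (dilation (1/r) (dilation r y))"
    using \<open>0 < r\<close> by (intro reach_dilation[OF g _ L(2)]) simp
  then show "y \<in> cc_ball g s"
    unfolding mem_cc_ball[OF g] using L(1) \<open>0 < r\<close>
    by (intro exI[of _ "(1/r) * L"]) (simp add: dilation_dilation field_simps)
qed

lemma cc_ball_nhd_0:
  assumes g: "inner_product_on V1 g" and "0 < r"
  obtains U where "open U" "0 \<in> U" "U \<subseteq> cc_ball g r"
proof -
  obtain K where K: "0 < K" "\<And>y. norm y \<le> 1 \<Longrightarrow> \<exists>L\<le>K. reach g L y"
    using reach_near_0[OF g] by metis
  \<comment> \<open>The factor 2 makes room for the strict inequality: only \<open>L \<le> K\<close>
    is known, so the Euclidean unit ball is placed in the ball of radius \<open>2 * K\<close> and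
    then shrunk by a dilation.\<close>
  define s where "s = r / (2 * K)"
  have s: "0 < s" "s * (2 * K) = r" using K \<open>0 < r\<close> by (auto simp: s_def)
  let ?U = "dilation (1/s) -` ball 0 1"
  have "open ?U" by (intro open_vimage continuous_intros) auto
  moreover have "0 \<in> ?U"
    using bounded_linear.linear[OF bounded_linear_dilation] by (simp add: linear_0)
  moreover have "?U \<subseteq> cc_ball g r"
  proof
    fix y assume "y \<in> ?U"
    then have "norm (dilation (1/s) y) \<le> 1" by simp
    then obtain L where "L \<le> K" "reach g L (dilation (1/s) y)" using K by blast
    then have "dilation (1/s) y \<in> cc_ball g (2 * K)"
      unfolding mem_cc_ball[OF g] using K(1) by (intro exI[of _ L]) simp
    then show "y \<in> cc_ball g r"
      using cc_ball_dilation[OF g s(1), of "dilation (1/s) y" "2 * K"] s by (simp add: dilation_dilation)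
  qed
  ultimately show ?thesis using that by blast
qed

text \<open>A point reached with length \<open>L < r\<close> leaves \<open>r - L\<close> to spend,
  and left translation moves a neighbourhood of 0 inside the ball of radius \<open>r - L\<close> to
  that point.\<close>

lemma open_cc_ball:
  assumes g: "inner_product_on V1 g"
  shows "open (cc_ball g r)"
proof (subst open_subopen, intro ballI)
  show "\<exists>T. open T \<and> y \<in> T \<and> T \<subseteq> cc_ball g r" if y: "y \<in> cc_ball g r" for y
  proof -
    obtain L where L: "L < r" "reach g L y" using y unfolding mem_cc_ball[OF g] by blast
    then obtain U where U: "open U" "0 \<in> U" "U \<subseteq> cc_ball g (r - L)"
      using cc_ball_nhd_0[OF g, of "r - L"] by auto
    let ?T = "(\<lambda>z. f23_inv y \<odot> z) -` U"
    have "open ?T" using U(1) by (intro open_vimage continuous_intros) auto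
    moreover have "y \<in> ?T" using U(2) by (simp add: f23.left_inverse)
    moreover have "?T \<subseteq> cc_ball g r"
    proof
      fix z assume "z \<in> ?T"
      then obtain M where M: "M < r - L" "reach g M (f23_inv y \<odot> z)"
        using U(3) mem_cc_ball[OF g] by blast
      then have "reach g (L + M) z" using reach_mult[OF g L(2) M(2)] by simp
      then show "z \<in> cc_ball g r"
        unfolding mem_cc_ball[OF g] using M(1) by (intro exI[of _ "L + M"]) simp
    qed
    ultimately show ?thesis by blast
  qed
qed

lemma bounded_cc_ball_1:
  assumes g: "inner_product_on V1 g"
  shows "bounded (cc_ball g 1)"
proof -
  obtain R where "\<And>L y. reach g L y \<Longrightarrow> L \<le> 1 \<Longrightarrow> norm y \<le> R" using reach_bounded[OF g] by metis
  then show ?thesis unfolding bounded_iff by (metis less_imp_le mem_cc_ball[OF g])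
qed

section \<open>Constant normal and limits of sets\<close>

lemma emeasure_haar_dilation:
  assumes "haar_measure M" "0 < r" "A \<in> sets borel"
  shows "emeasure M A = ennreal (r ^ 10) * emeasure M (dilation r -` A)"
proof -
  obtain c where c: "\<And>A. A \<in> sets borel \<Longrightarrow> emeasure M A = c * emeasure lborel A"
    using haar_measure_lborel[OF assms(1)] by metis
  have "dilation r -` A \<in> sets borel"
    using scales_lborel_dilation[OF \<open>0 < r\<close>] measurable_sets[of "dilation r" borel borel A] assms(3)
    by (simp add: scales_lborel_def)
  then show ?thesis
    using emeasure_vimage_scales_lborel[OF scales_lborel_dilation[OF \<open>0 < r\<close>] assms(3)] assms(3)
    by (simp add: c mult.left_commute)
qed

text \<open>Unimodularity: \<open>haar_measure\<close> postulates left invariance, and right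
  invariance is inherited from Lebesgue measure.\<close>

lemma distr_haar_right:
  assumes "haar_measure M"
  shows "distr M M (\<lambda>y. y \<odot> v) = M"
proof (rule measure_eqI)
  obtain c where c: "\<And>A. A \<in> sets borel \<Longrightarrow> emeasure M A = c * emeasure lborel A"
    using haar_measure_lborel[OF assms] by metis
  have meas: "(\<lambda>y. y \<odot> v) \<in> borel_measurable borel"
    using scales_lborel_right by (simp add: scales_lborel_def)
  fix A assume "A \<in> sets (distr M M (\<lambda>y. y \<odot> v))"
  then have A: "A \<in> sets borel" by (simp add: haar_measure_sets[OF assms])
  then have "(\<lambda>y. y \<odot> v) -` A \<in> sets borel"
    using measurable_sets[OF meas A] by simp
  then have "emeasure M ((\<lambda>y. y \<odot> v) -` A) = emeasure M A"
    using emeasure_vimage_scales_lborel[OF scales_lborel_right[of v] A] A by (simp add: c)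
  then show "emeasure (distr M M (\<lambda>y. y \<odot> v)) A = emeasure M A"
    using meas A haar_measure_sets[OF assms]
    by (subst emeasure_distr) (simp_all cong: measurable_cong_sets)
qed simp

lemma haar_measure_open_pos:
  assumes "haar_measure M" "open U" "U \<noteq> {}"
  shows "0 < emeasure M U"
proof -
  obtain c where c: "0 < c" "\<And>A. A \<in> sets borel \<Longrightarrow> emeasure M A = c * emeasure lborel A"
    using haar_measure_lborel[OF assms(1)] by metis
  have "emeasure lborel U \<noteq> 0"
  proof
    assume "emeasure lborel U = 0"
    then have "U \<in> null_sets lborel" using assms(2) by (simp add: null_sets_def)
    then have "negligible U" by (simp add: negligible_iff_null_sets null_sets_completionI)
    then show False using open_not_negligible assms(2,3) by blast
  qed
  then show ?thesis using c assms(2) by (simp add: zero_less_iff_neq_zero)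
qed

text \<open>\<open>left_inv_field\<close> is defined by a derivative at time 0. The mean value
  theorem in \<open>constant_normalI\<close> uses the whole curve, so the curve has to be an
  integral curve of the field at every time.\<close>

lemma has_vector_derivative_right_translation:
  "((\<lambda>t. p \<odot> (t *\<^sub>R v)) has_vector_derivative left_inv_field v (p \<odot> (t *\<^sub>R v))) (at t)"
proof -
  let ?L = "v + (1/2) *\<^sub>R lie_bracket p v + (1/12) *\<^sub>R lie_bracket p (lie_bracket p v)"
  let ?Q = "- (1/12) *\<^sub>R lie_bracket v (lie_bracket p v)"
  have eq: "p \<odot> (s *\<^sub>R v) = p + s *\<^sub>R ?L + (s * s) *\<^sub>R ?Q" for s
    by (cases p; cases v) (simp add: f23_mult_def field_simps)
  have "left_inv_field v (p \<odot> (t *\<^sub>R v)) = ?L + (t + t) *\<^sub>R ?Q"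
    by (cases p; cases v) (simp add: left_inv_field_eq f23_mult_def field_simps)
  then show ?thesis
    unfolding eq by (auto intro!: derivative_eq_intros)
qed

lemma test_function_derivative_along:
  assumes "test_function u"
  shows "((\<lambda>t. u (p \<odot> (t *\<^sub>R v))) has_real_derivative
    frechet_derivative u (at (p \<odot> (t *\<^sub>R v))) (left_inv_field v (p \<odot> (t *\<^sub>R v)))) (at t)"
proof -
  have "C_k 1 u" using assms unfolding test_function_def by blast
  then have "u differentiable (at (p \<odot> (t *\<^sub>R v)))" unfolding One_nat_def C_k.simps by blast
  then have "(u has_derivative frechet_derivative u (at (p \<odot> (t *\<^sub>R v)))) (at (p \<odot> (t *\<^sub>R v)))"
    by (simp add: frechet_derivative_works)
  from has_derivative_compose[OF has_vector_derivative_right_translation[unfolded has_vector_derivative_def] this]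
  have "((\<lambda>t. u (p \<odot> (t *\<^sub>R v))) has_derivative
     (\<lambda>s. frechet_derivative u (at (p \<odot> (t *\<^sub>R v))) (s *\<^sub>R left_inv_field v (p \<odot> (t *\<^sub>R v))))) (at t)" .
  moreover have "linear (frechet_derivative u (at (p \<odot> (t *\<^sub>R v))))"
    using \<open>u differentiable _\<close> by (rule linear_frechet_derivative)
  ultimately show ?thesis
    by (simp add: has_field_derivative_def linear_scale mult_commute_abs)
qed

text \<open>\<open>C_k\<close> gives continuity of the derivative in a fixed direction, while the
  direction here moves with \<open>p\<close>; expanding it in the standard basis separates the
  two.\<close>

lemma continuous_on_test_function_derivative:
  assumes "test_function u"
  shows "continuous_on UNIV (\<lambda>p. frechet_derivative u (at p) (left_inv_field v p))"
proof -
  have "C_k 1 u" using assms unfolding test_function_def by blast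
  then have d: "\<And>p. u differentiable (at p)"
    and c: "\<And>v. continuous_on UNIV (\<lambda>p. frechet_derivative u (at p) v)"
    unfolding One_nat_def C_k.simps by blast+
  have eq: "frechet_derivative u (at p) w = (\<Sum>b\<in>Basis. (w \<bullet> b) * frechet_derivative u (at p) b)" for p w
  proof -
    interpret l: linear "frechet_derivative u (at p)" using d by (rule linear_frechet_derivative)
    have "frechet_derivative u (at p) w = frechet_derivative u (at p) (\<Sum>b\<in>Basis. (w \<bullet> b) *\<^sub>R b)"
      by (simp only: euclidean_representation)
    then show ?thesis by (simp only: l.sum l.scale real_scaleR_def)
  qed
  have "continuous_on UNIV (left_inv_field v)"
    unfolding left_inv_field_eq by (intro continuous_intros lie_bracket.continuous_on)
  then show ?thesis
    unfolding eq[of _ "left_inv_field v _"] by (intro continuous_intros c)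
qed

text \<open>Left-invariant fields are the derivatives of right translations.  Since the Haar measure is
  also right-invariant, the difference quotients of a test function integrate over \<open>E\<close> to
  nonpositive numbers.\<close>

lemma constant_normalI:
  assumes M: "haar_measure M" and E: "E \<in> sets borel" and W: "half_space W"
    and stable: "\<And>p v. p \<in> E \<Longrightarrow> v \<in> W \<Longrightarrow> p \<odot> v \<in> E"
  shows "constant_normal M E"
proof -
  note sM = haar_measure_sets[OF M]
  note [measurable_cong] = sM(1)
  have scaleW: "t *\<^sub>R v \<in> W" if "v \<in> W" "0 \<le> t" for v t
  proof -
    obtain \<nu> where "W = {v \<in> V1. 0 \<le> \<nu> \<bullet> v}" using W unfolding half_space_def by blast
    with that V1_scale[of v t] show ?thesis by simp
  qed
  have main: "(LINT p:E|completion M. frechet_derivative u (at p) (left_inv_field v p)) \<le> 0"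
    if v: "v \<in> W" and u: "test_function u" and u0: "\<And>p. 0 \<le> u p" for v u
  proof -
    define X where "X p = frechet_derivative u (at p) (left_inv_field v p)" for p
    define D where "D n p = (u (p \<odot> (inverse (real (Suc n)) *\<^sub>R v)) - u p) / inverse (real (Suc n))" for n p
    define K where "K = closure {p. u p \<noteq> 0}"
    have K: "compact K" using u by (simp add: test_function_def K_def)
    \<comment> \<open>\<open>K1\<close> contains every point that the flow of \<open>v\<close>
      brings into the support within time 1, so the difference quotients vanish outside it.
      \<open>K2\<close> adds the intermediate points produced by the mean value theorem, where the
      derivative must be bounded.\<close>
    define K1 where "K1 = (\<lambda>(q, s). q \<odot> (s *\<^sub>R v)) ` (K \<times> {-1..0})"
    define K2 where "K2 = (\<lambda>(q, s). q \<odot> (s *\<^sub>R v)) ` (K1 \<times> {0..1})"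
    have cmult: "continuous_on S (\<lambda>(q, s). q \<odot> (s *\<^sub>R v))" for S
      unfolding case_prod_beta by (intro continuous_intros)
    have K1: "compact K1" unfolding K1_def using K cmult by (intro compact_continuous_image compact_Times) auto
    then have K2: "compact K2" unfolding K2_def using cmult by (intro compact_continuous_image compact_Times) auto
    have cX: "continuous_on UNIV X" unfolding X_def using continuous_on_test_function_derivative[OF u] .
    have cu: "continuous_on UNIV u" using u C_k.simps(1) unfolding test_function_def by blast
    have cuv: "continuous_on UNIV (\<lambda>p. u (p \<odot> w))" for w
      by (rule continuous_on_compose2[OF cu]) (auto intro!: continuous_intros)
    have [measurable]: "X \<in> borel_measurable borel" "u \<in> borel_measurable borel"
      "\<And>w. (\<lambda>p. u (p \<odot> w)) \<in> borel_measurable borel" "E \<in> sets borel"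
      using cX cu cuv E by (auto intro: borel_measurable_continuous_onI)
    have mD [measurable]: "D n \<in> borel_measurable borel" for n
      unfolding D_def by measurable
    have "bounded (X ` K2)"
      using cX K2 by (intro compact_imp_bounded compact_continuous_image) (auto intro: continuous_on_subset)
    then obtain C where C: "\<And>p. p \<in> K2 \<Longrightarrow> \<bar>X p\<bar> \<le> C" by (auto simp: bounded_iff)
    have KK1: "p \<in> K1" if "p \<odot> (s *\<^sub>R v) \<in> K" "0 \<le> s" "s \<le> 1" for p s
    proof -
      have "p = (p \<odot> (s *\<^sub>R v)) \<odot> ((- s) *\<^sub>R v)"
        using f23_inv_mult_cancel(3)[of p "s *\<^sub>R v"] by (simp add: f23_inv_def)
      then show ?thesis unfolding K1_def using that by (intro image_eqI[of _ _ "(p \<odot> (s *\<^sub>R v), - s)"]) auto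
    qed
    have inv_le: "0 < inverse (real (Suc n))" "inverse (real (Suc n)) \<le> 1" for n
      by (auto simp: field_simps)
    have D_bound: "\<bar>D n p\<bar> \<le> indicator K1 p * C" for n p
    proof (cases "p \<in> K1")
      case True
      obtain \<xi> where \<xi>: "0 < \<xi>" "\<xi> < inverse (real (Suc n))"
        "u (p \<odot> (inverse (real (Suc n)) *\<^sub>R v)) - u (p \<odot> (0 *\<^sub>R v)) =
          (inverse (real (Suc n)) - 0) * X (p \<odot> (\<xi> *\<^sub>R v))"
        using MVT2[OF inv_le(1)[of n] test_function_derivative_along[OF u]] unfolding X_def by blast
      have "D n p = X (p \<odot> (\<xi> *\<^sub>R v))"
        using \<xi>(3) by (simp add: D_def f23.right_neutral field_simps)
      moreover have "p \<odot> (\<xi> *\<^sub>R v) \<in> K2"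
        unfolding K2_def using True \<xi>(1,2) inv_le(2)[of n] by (intro image_eqI[of _ _ "(p, \<xi>)"]) auto
      ultimately show ?thesis using C True by simp
    next
      case False
      have "p \<odot> (inverse (real (Suc n)) *\<^sub>R v) \<notin> K" "p \<odot> (0 *\<^sub>R v) \<notin> K"
        using KK1 False inv_le less_imp_le by (metis, metis order_refl zero_le_one)
      moreover have "p \<odot> (0 *\<^sub>R v) = p" by (simp add: f23.right_neutral)
      moreover have "u q = 0" if "q \<notin> K" for q
        using that closure_subset[of "{p. u p \<noteq> 0}"] unfolding K_def by blast
      ultimately have "D n p = 0" by (simp add: D_def)
      then show ?thesis using False by simp
    qed
    have D_lim: "(\<lambda>n. D n p) \<longlonglongrightarrow> X p" for p
    proof -
      have "((\<lambda>t. u (p \<odot> (t *\<^sub>R v))) has_real_derivative X (p \<odot> (0 *\<^sub>R v))) (at 0)"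
        unfolding X_def by (rule test_function_derivative_along[OF u])
      then have "((\<lambda>h. (u (p \<odot> (h *\<^sub>R v)) - u p) / h) \<longlongrightarrow> X p) (at 0)"
        by (simp add: DERIV_def f23.right_neutral)
      moreover have "filterlim (\<lambda>n. inverse (real (Suc n))) (at 0) sequentially"
        using LIMSEQ_inverse_real_of_nat by (auto simp: filterlim_at)
      ultimately show ?thesis unfolding D_def by (rule filterlim_compose)
    qed
    have K1M: "K1 \<in> sets M" "emeasure M K1 < \<infinity>"
      using K1 M by (auto simp: sM haar_measure_def compact_imp_closed)
    have "(\<lambda>n. LINT p|M. indicator E p * D n p) \<longlonglongrightarrow> (LINT p|M. indicator E p * X p)"
    proof (rule integral_dominated_convergence[where w = "\<lambda>p. indicator K1 p * C"])
      show "integrable M (\<lambda>p. indicator K1 p * C)"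
        using integrableI_bounded_set_indicator[OF K1M(1) _ K1M(2), of "\<lambda>_. C" "\<bar>C\<bar>"] by simp
      show "AE p in M. (\<lambda>n. indicator E p * D n p) \<longlonglongrightarrow> indicator E p * X p"
        by (intro AE_I2 tendsto_intros D_lim)
      show "AE p in M. norm (indicator E p * D n p) \<le> indicator K1 p * C" for n
      proof (intro AE_I2)
        fix p show "norm (indicator E p * D n p) \<le> indicator K1 p * C"
          by (rule order_trans[OF _ D_bound[of n p]]) (simp add: indicator_def)
      qed
    qed measurable
    moreover have "(LINT p|M. indicator E p * D n p) \<le> 0" for n
    proof -
      let ?w = "inverse (real (Suc n)) *\<^sub>R v"
      have iu: "integrable M (\<lambda>p. u p)"
      proof -
        have KM: "K \<in> sets M" "emeasure M K < \<infinity>"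
          using K M by (auto simp: sM haar_measure_def compact_imp_closed)
        have "bounded (u ` K)"
          using cu K by (intro compact_imp_bounded compact_continuous_image) (auto intro: continuous_on_subset)
        then obtain b where "\<And>p. p \<in> K \<Longrightarrow> \<bar>u p\<bar> \<le> b" by (auto simp: bounded_iff)
        then have "integrable M (\<lambda>p. indicator K p *\<^sub>R u p)"
          using KM by (intro integrableI_bounded_set_indicator[where B = b]) auto
        moreover have "(\<lambda>p. indicator K p *\<^sub>R u p) = u"
          using closure_subset[of "{p. u p \<noteq> 0}"] unfolding K_def by (auto simp: indicator_def fun_eq_iff)
        ultimately show ?thesis by (simp only:)
      qed
      have mw: "(\<lambda>p. p \<odot> ?w) \<in> measurable M M"
        using scales_lborel_right[of ?w] by (simp add: scales_lborel_def sM cong: measurable_cong_sets)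
      have iuw: "integrable M (\<lambda>p. u (p \<odot> ?w))"
        using integrable_distr[OF mw, of u] iu by (simp add: distr_haar_right[OF M])
      have iE: "integrable M (\<lambda>p. indicator E p * u p)" "integrable M (\<lambda>p. indicator E p * u (p \<odot> ?w))"
        using integrable_mult_indicator[OF _ iu, of E] integrable_mult_indicator[OF _ iuw, of E] by auto
      have iEw: "integrable M (\<lambda>p. indicator E (p \<odot> ?w) * u (p \<odot> ?w))"
        using integrable_distr[OF mw, of "\<lambda>p. indicator E p * u p"] iE(1) by (simp add: distr_haar_right[OF M])
      \<comment> \<open>The sign comes from here: stability of \<open>E\<close> lets the indicator
        only grow under translation by \<open>?w\<close>, and the larger integral is a translate of
        the original one.\<close>
      have "(LINT p|M. indicator E p * u (p \<odot> ?w)) \<le> (LINT p|M. indicator E (p \<odot> ?w) * u (p \<odot> ?w))"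
      proof (rule integral_mono[OF iE(2) iEw])
        fix p show "indicator E p * u (p \<odot> ?w) \<le> indicator E (p \<odot> ?w) * u (p \<odot> ?w)"
          using stable[of p ?w] scaleW[OF v] u0[of "p \<odot> ?w"] by (auto simp: indicator_def)
      qed
      also have "\<dots> = (LINT p|distr M M (\<lambda>p. p \<odot> ?w). indicator E p * u p)"
        using mw by (subst integral_distr) auto
      also have "\<dots> = (LINT p|M. indicator E p * u p)" by (simp add: distr_haar_right[OF M])
      finally have "(LINT p|M. indicator E p * u (p \<odot> ?w)) - (LINT p|M. indicator E p * u p) \<le> 0" by simp
      moreover have "(LINT p|M. indicator E p * D n p) =
        ((LINT p|M. indicator E p * u (p \<odot> ?w)) - (LINT p|M. indicator E p * u p)) / inverse (real (Suc n))"
      proof -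
        have "indicator E p * D n p =
          (indicator E p * u (p \<odot> ?w) - indicator E p * u p) / inverse (real (Suc n))" for p
          by (simp only: D_def times_divide_eq_right right_diff_distrib)
        then show ?thesis by (simp only: integral_divide_zero Bochner_Integration.integral_diff[OF iE(2,1)])
      qed
      ultimately show ?thesis using inv_le(1)[of n] by (simp only: divide_nonpos_pos)
    qed
    ultimately have "(LINT p|M. indicator E p * X p) \<le> 0"
      by (intro LIMSEQ_le_const2) auto
    then show ?thesis
      unfolding set_lebesgue_integral_def X_def[symmetric] by (subst integral_completion) auto
  qed
  have "E \<in> sets (completion M)" using E sM by (simp add: sets_completionI_sets)
  moreover have "0 \<le> - (LINT p:E|completion M. frechet_derivative u (at p) (left_inv_field v p))"
    if "v \<in> W" "test_function u \<and> (\<forall>p. 0 \<le> u p)" for v u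
    using main[OF that(1), of u] that(2) by fastforce
  ultimately show ?thesis
    unfolding constant_normal_def using W by blast
qed

section \<open>Limits of sets, of their measures, and of densities along a sequence\<close>

lemma L1_loc_tendsto_indicatorI:
  assumes M: "haar_measure M"
    and E: "\<And>j. E j \<in> sets borel" and F: "F \<in> sets borel"
    and ae: "AE p in M. \<forall>\<^sub>F j in sequentially. p \<in> E j \<longleftrightarrow> p \<in> F"
  shows "L1_loc_tendsto M (\<lambda>j. indicator (E j)) (indicator F)"
  unfolding L1_loc_tendsto_def
proof (intro allI impI)
  note sM = haar_measure_sets[OF M]
  note [measurable_cong] = sM(1)
  fix K :: "f23 set" assume K: "compact K"
  have [measurable]: "E j \<in> sets borel" "F \<in> sets borel" "K \<in> sets borel" for j
    using E F K by (auto simp: compact_imp_closed)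
  have Kf: "emeasure M K < \<infinity>" using K M by (simp add: haar_measure_def)
  have "(\<lambda>j. LINT p|M. indicator K p * \<bar>indicator (E j) p - indicator F p :: real\<bar>) \<longlonglongrightarrow> (LINT p|M. (0::real))"
  proof (rule integral_dominated_convergence[where w = "indicator K"])
    show "integrable M (indicator K :: f23 \<Rightarrow> real)" using Kf sM by simp
    show "AE p in M. (\<lambda>j. indicator K p * \<bar>indicator (E j) p - indicator F p :: real\<bar>) \<longlonglongrightarrow> 0"
      using ae
    proof eventually_elim
      fix p assume "\<forall>\<^sub>F j in sequentially. p \<in> E j \<longleftrightarrow> p \<in> F"
      then show "(\<lambda>j. indicator K p * \<bar>indicator (E j) p - indicator F p :: real\<bar>) \<longlonglongrightarrow> 0"
        by (intro tendsto_eventually) (auto elim!: eventually_mono simp: indicator_def)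
    qed
  qed (auto simp: indicator_def)
  then show "(\<lambda>j. LINT p:K|completion M. \<bar>indicator (E j) p - indicator F p :: real\<bar>) \<longlonglongrightarrow> 0"
    unfolding set_lebesgue_integral_def by (subst integral_completion) auto
qed

lemma measure_Int_tendsto:
  assumes S: "S \<in> sets M" "emeasure M S < \<infinity>"
    and E: "\<And>j. E j \<in> sets M" and F: "F \<in> sets M"
    and ae: "AE p in M. \<forall>\<^sub>F j in sequentially. p \<in> E j \<longleftrightarrow> p \<in> F"
  shows "(\<lambda>j. measure M (S \<inter> E j)) \<longlonglongrightarrow> measure M (S \<inter> F)"
proof -
  have "(\<lambda>j. LINT p|M. indicator (S \<inter> E j) p :: real) \<longlonglongrightarrow> (LINT p|M. indicator (S \<inter> F) p)"
  proof (rule integral_dominated_convergence[where w = "indicator S"])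
    show "integrable M (indicator S :: 'a \<Rightarrow> real)" using S by simp
    show "AE p in M. (\<lambda>j. indicator (S \<inter> E j) p :: real) \<longlonglongrightarrow> indicator (S \<inter> F) p"
      using ae
    proof eventually_elim
      fix p assume "\<forall>\<^sub>F j in sequentially. p \<in> E j \<longleftrightarrow> p \<in> F"
      then show "(\<lambda>j. indicator (S \<inter> E j) p :: real) \<longlonglongrightarrow> indicator (S \<inter> F) p"
        by (intro tendsto_eventually) (auto elim!: eventually_mono simp: indicator_def)
    qed
  qed (use S E F in \<open>auto simp: indicator_def\<close>)
  then show ?thesis using S E F by simp
qed

text \<open>The density is computed along particular sequences of radii only; each such limit bounds
  one of the two densities on the side that their strict inequality uses.\<close>

lemma Liminf_le_tendsto:
  fixes f :: "'a \<Rightarrow> 'b::{complete_linorder, linorder_topology}"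
  assumes "filterlim s F sequentially" "(\<lambda>n. f (s n)) \<longlonglongrightarrow> l"
  shows "Liminf F f \<le> l"
  unfolding Liminf_def
proof (rule SUP_least)
  fix P assume "P \<in> {P. eventually P F}"
  then have "eventually (\<lambda>n. P (s n)) sequentially"
    using assms(1) by (simp add: filterlim_iff)
  then have "eventually (\<lambda>n. Inf (f ` Collect P) \<le> f (s n)) sequentially"
    by eventually_elim (auto intro: INF_lower)
  then show "Inf (f ` Collect P) \<le> l"
    using assms(2) by (intro tendsto_lowerbound) auto
qed

lemma tendsto_le_Limsup:
  fixes f :: "'a \<Rightarrow> 'b::{complete_linorder, linorder_topology}"
  assumes "filterlim s F sequentially" "(\<lambda>n. f (s n)) \<longlonglongrightarrow> l"
  shows "l \<le> Limsup F f"
  unfolding Limsup_def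
proof (rule INF_greatest)
  fix P assume "P \<in> {P. eventually P F}"
  then have "eventually (\<lambda>n. P (s n)) sequentially"
    using assms(1) by (simp add: filterlim_iff)
  then have "eventually (\<lambda>n. f (s n) \<le> Sup (f ` Collect P)) sequentially"
    by eventually_elim (auto intro: SUP_upper)
  then show "l \<le> Sup (f ` Collect P)"
    using assms(2) by (intro tendsto_upperbound) auto
qed

section \<open>The set with two blow-ups\<close>

text \<open>\<open>inv4\<close> and \<open>phi\<close> are constant along \<^const>\<open>X2\<close>; along \<^const>\<open>X1\<close> they have the
  derivatives \<open>- x1 * x2\<close> and \<open>(x1\<^sup>2 + x2\<^sup>2) / 2\<close>, so that \<open>phi\<close> grows at least as fast as
  \<open>inv4\<close> varies.\<close>

definition inv4 :: "f23 \<Rightarrow> real" where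
  "inv4 = (\<lambda>(x1, x2, x3, x4, x5). x4 - x1 * x3 / 2 - x1\<^sup>2 * x2 / 3)"

definition phi :: "f23 \<Rightarrow> real" where
  "phi = (\<lambda>(x1, x2, x3, x4, x5). x1 ^ 3 / 6 - (x5 - x2 * x3 / 2 - x1 * x2\<^sup>2 / 6))"

definition subgraph :: "(real \<Rightarrow> real) \<Rightarrow> f23 set" where
  "subgraph h = {p. h (inv4 p) < phi p}"

lemma continuous_on_inv4 [continuous_intros]: "continuous_on S inv4"
  unfolding inv4_def case_prod_beta by (intro continuous_intros) auto

lemma continuous_on_phi [continuous_intros]: "continuous_on S phi"
  unfolding phi_def case_prod_beta by (intro continuous_intros) auto

lemma inv4_dilation: "inv4 (dilation r p) = r ^ 3 * inv4 p"
  by (cases p) (simp add: inv4_def power2_eq_square power3_eq_cube field_simps)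

lemma phi_dilation: "phi (dilation r p) = r ^ 3 * phi p"
  by (cases p) (simp add: phi_def power2_eq_square power3_eq_cube field_simps)

lemma abs_inv4_diff_le_phi_diff:
  assumes "v \<in> V1" "0 \<le> fst v"
  shows "\<bar>inv4 (p \<odot> v) - inv4 p\<bar> \<le> phi (p \<odot> v) - phi p"
proof -
  obtain a b where v: "v = (a, b, 0, 0, 0)" "0 \<le> a" using assms by (auto simp: V1_iff)
  obtain x1 x2 x3 x4 x5 where p: "p = (x1, x2, x3, x4, x5)" by (cases p)
  let ?A = "inv4 (p \<odot> v) - inv4 p" and ?B = "phi (p \<odot> v) - phi p"
  \<comment> \<open>This is \<open>a / 2\<close> times the integral of \<open>(c + s * d)^2\<close>
    over \<open>s\<close> from 0 to 1. Along \<open>p \<odot> (s *\<^sub>R v)\<close> the sum and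
    the difference of the first two coordinates are affine in \<open>s\<close>, and half their
    squares are the rates at which \<open>phi - inv4\<close> and \<open>phi + inv4\<close> grow
    along \<open>X1\<close>.\<close>
  have "0 \<le> a / 2 * ((c + d / 2)\<^sup>2 + d\<^sup>2 / 12)" for c d :: real
    using v(2) by simp
  note nn = this[of "x1 + x2" "a + b"] this[of "x1 - x2" "a - b"]
  have "?B - ?A = a / 2 * ((x1 + x2 + (a + b) / 2)\<^sup>2 + (a + b)\<^sup>2 / 12)"
    "?B + ?A = a / 2 * ((x1 - x2 + (a - b) / 2)\<^sup>2 + (a - b)\<^sup>2 / 12)"
    by (simp_all add: v p inv4_def phi_def f23_mult_def power2_eq_square power3_eq_cube field_simps)
  then show ?thesis using nn by linarith
qed

lemma subgraph_stable:
  assumes lip: "\<And>x y. h x - h y \<le> \<bar>x - y\<bar>"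
    and "p \<in> subgraph h" "v \<in> V1" "0 \<le> fst v"
  shows "p \<odot> v \<in> subgraph h"
  using assms(2) abs_inv4_diff_le_phi_diff[OF assms(3,4), of p] lip[of "inv4 (p \<odot> v)" "inv4 p"]
  by (simp add: subgraph_def)

lemma open_subgraph:
  assumes "continuous_on UNIV h"
  shows "open (subgraph h)"
  unfolding subgraph_def
  by (intro open_Collect_less continuous_intros continuous_on_compose2[OF assms]) auto

lemma dilation_image_subgraph:
  assumes "0 < r"
  shows "dilation r ` subgraph h = subgraph (\<lambda>x. r ^ 3 * h (x / r ^ 3))"
proof
  show "dilation r ` subgraph h \<subseteq> subgraph (\<lambda>x. r ^ 3 * h (x / r ^ 3))"
    using assms unfolding subgraph_def by (auto simp only: inv4_dilation phi_dilation) simp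
  show "subgraph (\<lambda>x. r ^ 3 * h (x / r ^ 3)) \<subseteq> dilation r ` subgraph h"
  proof
    fix p assume p: "p \<in> subgraph (\<lambda>x. r ^ 3 * h (x / r ^ 3))"
    have "inv4 (dilation (1/r) p) = inv4 p / r ^ 3" "phi (dilation (1/r) p) = phi p / r ^ 3"
      unfolding inv4_dilation phi_dilation by (simp_all add: power_divide)
    moreover have "h (inv4 p / r ^ 3) < phi p / r ^ 3"
      using p assms by (simp add: subgraph_def field_simps)
    ultimately have "dilation (1/r) p \<in> subgraph h"
      by (simp add: subgraph_def)
    then show "p \<in> dilation r ` subgraph h"
      using assms by (intro image_eqI[of _ _ "dilation (1/r) p"]) (simp_all add: dilation_dilation)
  qed
qed

text \<open>\<open>phi\<close> contains \<open>x5\<close> linearly and \<open>inv4\<close> does not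
  contain it, so the boundary is a graph over the first four coordinates. The shear \<open>T\<close>
  maps exactly its points into the hyperplane \<open>x5 = 0\<close> and preserves Lebesgue
  measure.\<close>

lemma AE_phi_neq:
  assumes M: "haar_measure M" and h: "continuous_on UNIV h"
  shows "AE p in M. phi p \<noteq> h (inv4 p)"
proof -
  obtain c where c: "\<And>A. A \<in> sets borel \<Longrightarrow> emeasure M A = c * emeasure lborel A"
    using haar_measure_lborel[OF M] by metis
  define T where "T = (\<lambda>(x1, x2, x3, x4, x5). (1 * x1 + 0, 1 * x2 + (0::real), 1 * x3 + (0::real),
    1 * x4 + (0::real), (1::real) * x5 + (h (x4 - x1 * x3 / 2 - x1\<^sup>2 * x2 / 3) - x1 ^ 3 / 6
      - x2 * x3 / 2 - x1 * x2\<^sup>2 / 6)))"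
  have "scales_lborel (\<bar>1\<bar> * (\<bar>1\<bar> * (\<bar>1\<bar> * (\<bar>1\<bar> * \<bar>1\<bar>)))) T"
    unfolding T_def
    by (rule scales_lborel_triangular)
       (auto simp: case_prod_beta intro!: continuous_intros continuous_on_compose2[OF h])
  then have T: "scales_lborel 1 T" by simp
  have X5: "X5 \<in> Basis" by (simp add: X5_def Basis_prod_def zero_prod_def image_iff)
  have H: "{x. x \<bullet> X5 = 0} \<in> sets borel"
    by (intro borel_closed closed_Collect_eq continuous_intros)
  have "negligible {x. x \<bullet> X5 = 0}" using X5 by (rule negligible_standard_hyperplane)
  then have "emeasure lborel {x. x \<bullet> X5 = 0} = 0"
    using H by (simp add: negligible_iff_null_sets null_sets_completion_iff null_setsD1)
  then have "emeasure lborel (T -` {x. x \<bullet> X5 = 0}) = 0"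
    using emeasure_vimage_scales_lborel[OF T H] by simp
  moreover have "T -` {x. x \<bullet> X5 = 0} = {p. phi p = h (inv4 p)}"
    by (auto simp: T_def X5_def phi_def inv4_def)
  moreover have N: "{p. phi p = h (inv4 p)} \<in> sets borel"
    by (intro borel_closed closed_Collect_eq continuous_intros continuous_on_compose2[OF h]) auto
  ultimately have "{p. phi p = h (inv4 p)} \<in> null_sets M"
    using haar_measure_sets[OF M] by (simp add: null_sets_def c)
  then show ?thesis by (rule AE_I') auto
qed

text \<open>Off the limiting boundary one of two strict inequalities holds, and a strict inequality
  passes to all late terms of a convergent sequence. Pointwise convergence of the functions is
  therefore enough.\<close>

lemma AE_eventually_mem_subgraph:
  assumes M: "haar_measure M" and k: "continuous_on UNIV k"
    and lim: "\<And>x. (\<lambda>j. h j x) \<longlonglongrightarrow> k x"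
  shows "AE p in M. \<forall>\<^sub>F j in sequentially. p \<in> subgraph (h j) \<longleftrightarrow> p \<in> subgraph k"
  using AE_phi_neq[OF M k]
proof eventually_elim
  fix p assume "phi p \<noteq> k (inv4 p)"
  then consider "k (inv4 p) < phi p" | "phi p < k (inv4 p)" by linarith
  then show "\<forall>\<^sub>F j in sequentially. p \<in> subgraph (h j) \<longleftrightarrow> p \<in> subgraph k"
  proof cases
    case 1
    from order_tendstoD(2)[OF lim 1] show ?thesis
      by eventually_elim (use 1 in \<open>simp add: subgraph_def\<close>)
  next
    case 2
    from order_tendstoD(1)[OF lim 2] show ?thesis
      by eventually_elim (use 2 in \<open>simp add: subgraph_def\<close>)
  qed
qed

section \<open>A distance function with two behaviours at small scales\<close>

text \<open>The ratio of consecutive endpoints tends to infinity, so that at the scales \<open>blow_scale\<close>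
  the set looks alternately like the line and like a half-line.\<close>

definition sparse_set :: "real set" where
  "sparse_set = {..0} \<union> (\<Union>k\<in>{k. even k}. {exp (- (real k + 1)\<^sup>2)..exp (- (real k)\<^sup>2)})"

text \<open>The cube \<open>exp (m^2 + m)\<close> lies near the geometric mean of
  \<open>exp (m^2)\<close> and \<open>exp ((m + 1)^2)\<close>. It stretches the \<open>m\<close>-th
  interval to the one from \<open>exp (- m - 1)\<close> to \<open>exp m\<close>, and these exhaust
  the positive half-line. The division by 3 compensates the degree of \<open>inv4\<close> and
  \<open>phi\<close>.\<close>

definition blow_scale :: "nat \<Rightarrow> real" where
  "blow_scale m = exp (((real m)\<^sup>2 + real m) / 3)"

lemma blow_scale_pos: "0 < blow_scale m"
  by (simp add: blow_scale_def)

lemma blow_scale_cube: "blow_scale m ^ 3 = exp ((real m)\<^sup>2 + real m)"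
  unfolding blow_scale_def exp_of_nat_mult[symmetric] by simp

lemma filterlim_blow_scale: "filterlim blow_scale at_top sequentially"
proof -
  have "filterlim (\<lambda>m. ((real m)\<^sup>2 + real m) / 3) at_top sequentially"
  proof (rule filterlim_at_top_mono)
    show "filterlim (\<lambda>m. (1 / 3) * real m) at_top sequentially"
      by (intro filterlim_tendsto_pos_mult_at_top[OF tendsto_const _ filterlim_real_sequentially]) simp
  qed (auto simp: field_simps)
  then show ?thesis unfolding blow_scale_def by (rule filterlim_compose[OF exp_at_top])
qed

definition rescaled :: "nat \<Rightarrow> real \<Rightarrow> real" where
  "rescaled m x = blow_scale m ^ 3 * infdist (x / blow_scale m ^ 3) sparse_set"

lemma zero_in_sparse_set: "0 \<in> sparse_set"
  by (simp add: sparse_set_def)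

lemma rescaled_nonpos: "x \<le> 0 \<Longrightarrow> rescaled m x = 0"
proof -
  assume "x \<le> 0"
  then have "x / blow_scale m ^ 3 \<in> sparse_set"
    using blow_scale_pos[of m] by (simp add: sparse_set_def divide_nonpos_pos)
  then show ?thesis by (simp add: rescaled_def)
qed

lemma rescaled_even:
  assumes "even m" "exp (- real m - 1) \<le> x" "x \<le> exp (real m)"
  shows "rescaled m x = 0"
proof -
  let ?l = "exp ((real m)\<^sup>2 + real m)"
  have "exp (- real m - 1) / ?l \<le> x / ?l" "x / ?l \<le> exp (real m) / ?l"
    using assms by (simp_all add: divide_right_mono)
  moreover have "exp (- real m - 1) / ?l = exp (- (real m + 1)\<^sup>2)" "exp (real m) / ?l = exp (- (real m)\<^sup>2)"
    by (simp_all add: exp_diff[symmetric] power2_eq_square algebra_simps)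
  ultimately have "x / ?l \<in> sparse_set"
    using assms(1) unfolding sparse_set_def by auto
  then show ?thesis by (simp add: rescaled_def blow_scale_cube)
qed

lemma rescaled_le: "rescaled m x \<le> \<bar>x\<bar>"
proof -
  have "infdist (x / blow_scale m ^ 3) sparse_set \<le> \<bar>x\<bar> / blow_scale m ^ 3"
    using infdist_le[OF zero_in_sparse_set, of "x / blow_scale m ^ 3"] blow_scale_pos[of m]
    by (simp add: dist_real_def)
  then show ?thesis using blow_scale_pos[of m] by (simp add: rescaled_def field_simps)
qed

text \<open>For odd \<open>m\<close> the stretched interval from \<open>exp (- m - 1)\<close> to
  \<open>exp m\<close> is a gap of the set. The condition \<open>2 * x \<le> exp m\<close> puts the
  right end at distance at least \<open>x\<close>, so the left end decides the bound.\<close>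

lemma rescaled_odd_ge:
  assumes "odd m" "2 * x \<le> exp (real m)"
  shows "x - exp (- real m - 1) \<le> rescaled m x"
proof -
  let ?l = "exp ((real m)\<^sup>2 + real m)"
  have e: "exp (- real m - 1) = ?l * exp (- (real m + 1)\<^sup>2)" "exp (real m) = ?l * exp (- (real m)\<^sup>2)"
    by (simp_all add: exp_add[symmetric] power2_eq_square algebra_simps)
  have "(x - exp (- real m - 1)) / ?l \<le> dist (x / ?l) a" if a: "a \<in> sparse_set" for a
  proof -
    have "a \<le> exp (- (real m + 1)\<^sup>2) \<or> exp (- (real m)\<^sup>2) \<le> a"
    proof (cases "a \<le> 0")
      case False
      then obtain k where k: "even k" "exp (- (real k + 1)\<^sup>2) \<le> a" "a \<le> exp (- (real k)\<^sup>2)"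
        using a by (auto simp: sparse_set_def)
      then consider "k + 1 \<le> m" | "m + 1 \<le> k" using assms(1) by (metis Suc_eq_plus1 Suc_leI nat_neq_iff)
      then show ?thesis
      proof cases
        case 1
        then have "(real k + 1)\<^sup>2 \<le> (real m)\<^sup>2" by (intro power_mono) auto
        then have "exp (- (real m)\<^sup>2) \<le> exp (- (real k + 1)\<^sup>2)" by simp
        then show ?thesis using k(2) by linarith
      next
        case 2
        then have "(real m + 1)\<^sup>2 \<le> (real k)\<^sup>2" by (intro power_mono) auto
        then have "exp (- (real k)\<^sup>2) \<le> exp (- (real m + 1)\<^sup>2)" by simp
        then show ?thesis using k(3) by linarith
      qed
    qed (auto intro: order_trans[OF _ less_imp_le[OF exp_gt_zero]])
    then have "x - exp (- real m - 1) \<le> x - ?l * a \<or> x - exp (- real m - 1) \<le> ?l * a - x"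
    proof
      assume "a \<le> exp (- (real m + 1)\<^sup>2)"
      then have "?l * a \<le> exp (- real m - 1)" unfolding e by (intro mult_left_mono) auto
      then show ?thesis by simp
    next
      assume "exp (- (real m)\<^sup>2) \<le> a"
      then have "exp (real m) \<le> ?l * a" unfolding e by (intro mult_left_mono) auto
      moreover have "0 < exp (- real m - 1)" by simp
      ultimately show ?thesis using assms(2) by linarith
    qed
    then have "x - exp (- real m - 1) \<le> \<bar>x - ?l * a\<bar>" by linarith
    also have "\<dots> = ?l * dist (x / ?l) a"
    proof -
      have "x - ?l * a = ?l * (x / ?l - a)" by (simp add: right_diff_distrib)
      then show ?thesis by (simp add: dist_real_def abs_mult)
    qed
    finally show ?thesis by (simp add: field_simps)
  qed
  then have "(x - exp (- real m - 1)) / ?l \<le> infdist (x / ?l) sparse_set"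
    using zero_in_sparse_set unfolding infdist_def by (auto intro!: cINF_greatest)
  then show ?thesis by (simp add: rescaled_def blow_scale_cube field_simps)
qed

lemma exp_at_top_compose:
  assumes "filterlim s at_top sequentially"
  shows "\<forall>\<^sub>F j in sequentially. y \<le> exp (real (s j))"
    and "(\<lambda>j. exp (- real (s j) - 1)) \<longlonglongrightarrow> 0"
proof -
  have s: "filterlim (\<lambda>j. real (s j)) at_top sequentially"
    using filterlim_compose[OF filterlim_real_sequentially assms] .
  then show "\<forall>\<^sub>F j in sequentially. y \<le> exp (real (s j))"
    using filterlim_compose[OF exp_at_top s] by (simp add: filterlim_at_top)
  have "filterlim (\<lambda>j. real (s j) + 1) at_top sequentially"
    by (rule filterlim_at_top_mono[OF s]) simp
  then have "filterlim (\<lambda>j. - (real (s j) + 1)) at_bot sequentially"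
    by (simp only: filterlim_uminus_at_top)
  from filterlim_compose[OF exp_at_bot this]
  show "(\<lambda>j. exp (- real (s j) - 1)) \<longlonglongrightarrow> 0"
    by (simp only: minus_add_distrib diff_conv_add_uminus)
qed

lemma rescaled_even_tendsto: "(\<lambda>j. rescaled (2 * j) x) \<longlonglongrightarrow> 0"
proof (cases "x \<le> 0")
  case True
  then show ?thesis by (simp add: rescaled_nonpos)
next
  case False
  have s: "filterlim (\<lambda>j. 2 * j) at_top (sequentially :: nat filter)"
    by (rule filterlim_subseq) (simp add: strict_mono_def)
  have "\<forall>\<^sub>F j in sequentially. exp (- real (2 * j) - 1) < x"
    using order_tendstoD(2)[OF exp_at_top_compose(2)[OF s]] False by simp
  with exp_at_top_compose(1)[OF s, of x]
  have "\<forall>\<^sub>F j in sequentially. rescaled (2 * j) x = 0"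
    by eventually_elim (intro rescaled_even; simp)
  then show ?thesis by (rule tendsto_eventually)
qed

lemma rescaled_odd_tendsto: "(\<lambda>j. rescaled (2 * j + 1) x) \<longlonglongrightarrow> max 0 x"
proof (cases "x \<le> 0")
  case True
  then show ?thesis by (simp add: rescaled_nonpos)
next
  case False
  have s: "filterlim (\<lambda>j. 2 * j + 1) at_top (sequentially :: nat filter)"
    by (rule filterlim_subseq) (simp add: strict_mono_def)
  have "(\<lambda>j. rescaled (2 * j + 1) x) \<longlonglongrightarrow> x"
  proof (rule tendsto_sandwich)
    show "(\<lambda>j. x - exp (- real (2 * j + 1) - 1)) \<longlonglongrightarrow> x"
      using tendsto_diff[OF tendsto_const[of x] exp_at_top_compose(2)[OF s]] by simp
    show "\<forall>\<^sub>F j in sequentially. x - exp (- real (2 * j + 1) - 1) \<le> rescaled (2 * j + 1) x"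
      using exp_at_top_compose(1)[OF s, of "2 * x"]
      by eventually_elim (intro rescaled_odd_ge; simp)
    show "\<forall>\<^sub>F j in sequentially. rescaled (2 * j + 1) x \<le> x"
      using rescaled_le[of _ x] False by simp
  qed auto
  then show ?thesis using False by simp
qed

section \<open>Normal, blow-ups and densities of the constructed set\<close>

definition sparse_subgraph :: "f23 set" where
  "sparse_subgraph = subgraph (\<lambda>x. infdist x sparse_set)"

lemma constant_normal_sparse_subgraph:
  assumes "haar_measure M"
  shows "constant_normal M sparse_subgraph"
proof (rule constant_normalI[OF assms])
  show "sparse_subgraph \<in> sets borel"
    unfolding sparse_subgraph_def by (intro borel_open open_subgraph continuous_intros)
  \<comment> \<open>This half-space contains both \<open>X2\<close> and \<open>- X2\<close>, which
    encodes invariance along \<open>X2\<close>.\<close>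
  show "half_space {v \<in> V1. 0 \<le> X1 \<bullet> v}"
    unfolding half_space_def by (rule bexI[of _ X1]) (auto simp: V1_def span_base X1_def zero_prod_def)
  fix p v assume "p \<in> sparse_subgraph" and v: "v \<in> {v \<in> V1. 0 \<le> X1 \<bullet> v}"
  moreover have "0 \<le> fst v" using v by (cases v) (simp add: X1_def)
  ultimately show "p \<odot> v \<in> sparse_subgraph"
    unfolding sparse_subgraph_def
    by (intro subgraph_stable) (use infdist_triangle_abs[of _ sparse_set] in \<open>auto simp: dist_real_def abs_le_iff\<close>)
qed

lemma dilation_sparse_subgraph:
  "dilation (blow_scale m) ` sparse_subgraph = subgraph (rescaled m)"
  unfolding sparse_subgraph_def rescaled_def by (rule dilation_image_subgraph[OF blow_scale_pos])

lemma continuous_on_rescaled: "continuous_on UNIV (rescaled m)"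
  unfolding rescaled_def using blow_scale_pos[of m] by (intro continuous_intros) auto

lemma blow_up_sparse_subgraph:
  assumes M: "haar_measure M" and s: "filterlim s at_top sequentially"
    and k: "continuous_on UNIV k" and lim: "\<And>x. (\<lambda>j. rescaled (s j) x) \<longlonglongrightarrow> k x"
  shows "blow_up M sparse_subgraph 0 (subgraph k)"
proof -
  have "(\<lambda>y. f23_inv 0 \<odot> y) ` sparse_subgraph = sparse_subgraph"
    by (simp add: f23_inv_def f23.left_neutral)
  moreover have "L1_loc_tendsto M (\<lambda>j. indicator (subgraph (rescaled (s j)))) (indicator (subgraph k))"
    using open_subgraph continuous_on_rescaled k
    by (intro L1_loc_tendsto_indicatorI[OF M] AE_eventually_mem_subgraph[OF M k lim]) (auto intro: borel_open)
  ultimately show ?thesis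
    unfolding blow_up_def
    using filterlim_compose[OF filterlim_blow_scale s] blow_scale_pos open_subgraph[OF k] haar_measure_sets(1)[OF M]
    by (intro conjI exI[of _ "\<lambda>j. blow_scale (s j)"])
       (auto simp: dilation_sparse_subgraph sets_completionI_sets)
qed

lemma haar_measure_cc_ball:
  assumes M: "haar_measure M" and g: "inner_product_on V1 g"
  shows "cc_ball g 1 \<in> sets M" "emeasure M (cc_ball g 1) < \<infinity>" "0 < measure M (cc_ball g 1)"
proof -
  note sM = haar_measure_sets[OF M]
  show B: "cc_ball g 1 \<in> sets M" using open_cc_ball[OF g] by (simp add: sM)
  have "emeasure M (cc_ball g 1) \<le> emeasure M (closure (cc_ball g 1))"
    by (intro emeasure_mono closure_subset) (simp add: sM)
  also have "\<dots> < \<infinity>"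
    using M bounded_cc_ball_1[OF g] compact_closure[of "cc_ball g 1"] by (simp only: haar_measure_def)
  finally show fin: "emeasure M (cc_ball g 1) < \<infinity>" .
  obtain U where "0 \<in> U" "U \<subseteq> cc_ball g 1" using cc_ball_nhd_0[OF g, of 1] by auto
  then have "0 < emeasure M (cc_ball g 1)"
    by (intro haar_measure_open_pos[OF M open_cc_ball[OF g]]) auto
  then show "0 < measure M (cc_ball g 1)"
    using fin by (simp add: measure_def enn2real_positive_iff)
qed

text \<open>Dilating by \<open>blow_scale m\<close> replaces a shrinking ball and a fixed set by the
  fixed unit ball and a changing set; the Jacobian cancels in the quotient. Densities are then
  governed by the same limits as the blow-ups.\<close>

lemma density_ratio_sparse_subgraph:
  assumes M: "haar_measure M" and g: "inner_product_on V1 g"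
  shows "density_ratio M (cc_dist g) 0 sparse_subgraph (1 / blow_scale m) =
    ennreal (measure M (cc_ball g 1 \<inter> subgraph (rescaled m)) / measure M (cc_ball g 1))"
proof -
  note sM = haar_measure_sets[OF M]
  let ?r = "blow_scale m" and ?B = "cc_ball g 1" and ?S = "subgraph (rescaled m)"
  have r: "0 < ?r" by (rule blow_scale_pos)
  have B: "dilation ?r -` ?B = cc_ball g (1 / ?r)"
    using cc_ball_dilation[OF g r, of _ "1 / ?r"] r by auto
  have inj: "inj (dilation ?r)"
    by (rule inj_on_inverseI[of _ "dilation (1 / ?r)"]) (use r in \<open>simp add: dilation_dilation\<close>)
  have S: "dilation ?r -` ?S = sparse_subgraph"
    using inj_vimage_image_eq[OF inj] by (metis dilation_sparse_subgraph)
  have oB: "open ?B" "open ?S" by (intro open_cc_ball[OF g] open_subgraph continuous_on_rescaled)+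
  have fin: "emeasure M ?B < \<infinity>" "0 < measure M ?B" using haar_measure_cc_ball[OF M g] by auto
  have eB: "emeasure M ?B = ennreal (measure M ?B)"
    using fin by (simp add: emeasure_eq_ennreal_measure)
  have "emeasure M (?B \<inter> ?S) \<le> emeasure M ?B" using oB by (intro emeasure_mono) (auto simp: sM)
  then have eS: "emeasure M (?B \<inter> ?S) = ennreal (measure M (?B \<inter> ?S))"
    using fin by (intro emeasure_eq_ennreal_measure) auto
  have scale: "emeasure M (dilation ?r -` A) = ennreal (measure M A / ?r ^ 10)"
    if "open A" "emeasure M A = ennreal (measure M A)" for A
  proof -
    have "ennreal (?r ^ 10) * emeasure M (dilation ?r -` A) = ennreal (measure M A)"
      using emeasure_haar_dilation[OF M r, of A] that by simp
    then have "emeasure M (dilation ?r -` A) = ennreal (measure M A) / ennreal (?r ^ 10)"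
      using r by (metis ennreal_mult_divide_eq ennreal_neq_top mult.commute ennreal_eq_0_iff
          not_less zero_less_power)
    then show ?thesis using r by (simp add: divide_ennreal)
  qed
  have "open (cc_ball g (1 / ?r))" by (rule open_cc_ball[OF g])
  moreover have "open sparse_subgraph"
    unfolding sparse_subgraph_def by (intro open_subgraph continuous_intros)
  ultimately have sets: "cc_ball g (1 / ?r) \<in> sets M" "cc_ball g (1 / ?r) \<inter> sparse_subgraph \<in> sets M"
    by (auto simp: sM)
  have "density_ratio M (cc_dist g) 0 sparse_subgraph (1 / ?r) =
    emeasure M (dilation ?r -` (?B \<inter> ?S)) / emeasure M (dilation ?r -` ?B)"
    unfolding density_ratio_def cc_ball_def[symmetric] vimage_Int B S using sets by simp
  also have "\<dots> = ennreal (measure M (?B \<inter> ?S) / ?r ^ 10) / ennreal (measure M ?B / ?r ^ 10)"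
    using scale[OF oB(1) eB] scale[OF open_Int[OF oB] eS] by (simp only:)
  also have "\<dots> = ennreal (measure M (?B \<inter> ?S) / measure M ?B)"
    using r fin(2) by (subst divide_ennreal) simp_all
  finally show ?thesis .
qed

lemma density_ratio_tendsto:
  assumes M: "haar_measure M" and g: "inner_product_on V1 g"
    and k: "continuous_on UNIV k" and lim: "\<And>x. (\<lambda>j. rescaled (s j) x) \<longlonglongrightarrow> k x"
  shows "(\<lambda>j. density_ratio M (cc_dist g) 0 sparse_subgraph (1 / blow_scale (s j))) \<longlonglongrightarrow>
    ennreal (measure M (cc_ball g 1 \<inter> subgraph k) / measure M (cc_ball g 1))"
  unfolding density_ratio_sparse_subgraph[OF M g]
proof (intro tendsto_ennrealI tendsto_divide tendsto_const)
  show "(\<lambda>j. measure M (cc_ball g 1 \<inter> subgraph (rescaled (s j)))) \<longlonglongrightarrow> measure M (cc_ball g 1 \<inter> subgraph k)"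
    using open_subgraph continuous_on_rescaled k
    by (intro measure_Int_tendsto haar_measure_cc_ball[OF M g] AE_eventually_mem_subgraph[OF M k lim])
       (auto simp: haar_measure_sets[OF M])
  show "measure M (cc_ball g 1) \<noteq> 0" using haar_measure_cc_ball(3)[OF M g] by simp
qed

lemma filterlim_inverse_blow_scale:
  assumes "filterlim s at_top sequentially"
  shows "filterlim (\<lambda>j. 1 / blow_scale (s j)) (at_right 0) sequentially"
  using filterlim_compose[OF filterlim_inverse_at_right_top filterlim_compose[OF filterlim_blow_scale assms]]
  by (simp add: inverse_eq_divide)

theorem theorem6p3:
  fixes vol :: "f23 measure" and \<rho> :: "f23 \<Rightarrow> f23 \<Rightarrow> real"
  assumes "haar_measure vol" and "carnot_distance \<rho>"
  shows "\<exists>E x. constant_normal vol E \<and>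
           (\<exists>F G. blow_up vol E x F \<and> blow_up vol E x G \<and>
              \<not> (AE p in completion vol. p \<in> F \<longleftrightarrow> p \<in> G)) \<and>
           lower_density vol \<rho> x E < upper_density vol \<rho> x E"
proof -
  note M = assms(1)
  note sM = haar_measure_sets[OF M]
  obtain g where g: "inner_product_on V1 g" and \<rho>: "\<rho> = cc_dist g"
    using assms(2) by (auto simp: carnot_distance_def)
  let ?F = "subgraph (max 0)" and ?G = "subgraph (\<lambda>_. 0)" and ?B = "cc_ball g 1"
  have s0: "filterlim (\<lambda>j. 2 * j) at_top (sequentially :: nat filter)"
    and s1: "filterlim (\<lambda>j. 2 * j + 1) at_top (sequentially :: nat filter)"
    by (intro filterlim_subseq; simp add: strict_mono_def)+
  have k0: "continuous_on UNIV (\<lambda>_::real. 0::real)" and k1: "continuous_on UNIV (max (0::real))"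
    by (intro continuous_intros)+
  have opens: "open ?F" "open ?G" "open ?B"
    by (intro open_subgraph open_cc_ball[OF g] k0 k1)+
  \<comment> \<open>An open piece of \<open>?G - ?F\<close> inside the unit ball. The inclusion of
    \<open>?F\<close> in \<open>?G\<close> holds because \<open>max 0\<close> is nonnegative, so
    this one set separates both the blow-ups and the densities.\<close>
  define D where "D = ?B \<inter> {p. 0 < phi p \<and> phi p < inv4 p}"
  have oD: "open D"
    unfolding D_def by (intro open_Int opens(3) open_Collect_conj open_Collect_less continuous_intros)
  have "D \<noteq> {}"
  proof -
    \<comment> \<open>With the first three coordinates 0, \<open>inv4\<close> is the fourth
      coordinate and \<open>phi\<close> is minus the fifth, so 2 and -1 realise 0 < 1 < 2. By
      homogeneity these inequalities survive the dilation into the unit ball.\<close>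
    let ?q = "(0, 0, 0, 2, -1) :: f23"
    obtain L where L: "reach g L ?q" using reach_near_0[OF g] by metis
    then have "0 \<le> L" by (rule reach_nonneg[OF g])
    define R where "R = L + 1"
    have R: "0 < R" "?q \<in> cc_ball g R" using L \<open>0 \<le> L\<close> by (auto simp: R_def mem_cc_ball[OF g] intro!: exI[of _ L])
    have "dilation (1 / R) ?q \<in> ?B"
      using cc_ball_dilation[OF g, of "1 / R" ?q R] R by simp
    moreover have "phi ?q = 1" "inv4 ?q = 2" by (simp_all add: phi_def inv4_def)
    then have "0 < phi (dilation (1 / R) ?q)" "phi (dilation (1 / R) ?q) < inv4 (dilation (1 / R) ?q)"
      unfolding phi_dilation inv4_dilation using R(1) by (simp_all del: dilation.simps)
    ultimately show ?thesis unfolding D_def by blast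
  qed
  with oD have D: "0 < emeasure vol D" by (rule haar_measure_open_pos[OF M])
  have FG: "\<not> (AE p in completion vol. p \<in> ?F \<longleftrightarrow> p \<in> ?G)"
  proof
    assume "AE p in completion vol. p \<in> ?F \<longleftrightarrow> p \<in> ?G"
    then have "AE p in vol. p \<in> ?F \<longleftrightarrow> p \<in> ?G" by (simp add: AE_completion_iff)
    then have "AE p in vol. p \<notin> D"
      by eventually_elim (auto simp: D_def subgraph_def)
    then have "emeasure vol D = 0" using oD sM by (simp add: AE_iff_measurable[of D])
    with D show False by simp
  qed
  have less: "measure vol (?B \<inter> ?F) < measure vol (?B \<inter> ?G)"
  proof -
    note B = haar_measure_cc_ball[OF M g]
    have fm: "A \<in> fmeasurable vol" if "open A" "A \<subseteq> ?B" for A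
      using that B by (intro fmeasurableI2[of ?B vol A]) (auto simp: fmeasurable_def sM)
    have "measure vol (?B \<inter> ?F) + measure vol D = measure vol ((?B \<inter> ?F) \<union> D)"
    proof (rule measure_Union[symmetric])
      have "?B \<inter> ?F \<in> fmeasurable vol" "D \<in> fmeasurable vol"
        using opens oD by (intro fm; auto simp: D_def)+
      then show "emeasure vol (?B \<inter> ?F) \<noteq> \<infinity>" "emeasure vol D \<noteq> \<infinity>"
        "?B \<inter> ?F \<in> sets vol" "D \<in> sets vol"
        using fmeasurableD2 by auto
    qed (auto simp: D_def subgraph_def)
    also have "\<dots> \<le> measure vol (?B \<inter> ?G)"
      using opens oD by (intro measure_mono_fmeasurable fm) (auto simp: D_def subgraph_def sM)
    finally have "measure vol (?B \<inter> ?F) + measure vol D \<le> measure vol (?B \<inter> ?G)" .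
    moreover have "0 < measure vol D"
      using D fm[of D] oD by (auto simp: D_def measure_def enn2real_positive_iff fmeasurable_def)
    ultimately show ?thesis by simp
  qed
  let ?d = "\<lambda>k. ennreal (measure vol (?B \<inter> subgraph k) / measure vol ?B)"
  \<comment> \<open>Odd scales produce the smaller blow-up and bound the lower density from above;
    even scales produce the larger one and bound the upper density from below.\<close>
  have "lower_density vol \<rho> 0 sparse_subgraph \<le> ?d (max 0)"
    unfolding lower_density_def \<rho>
    by (rule Liminf_le_tendsto[OF filterlim_inverse_blow_scale[OF s1]
          density_ratio_tendsto[OF M g k1 rescaled_odd_tendsto]])
  also have "\<dots> < ?d (\<lambda>_. 0)"
    using less haar_measure_cc_ball(3)[OF M g] le_less_trans[OF measure_nonneg less]
    by (intro ennreal_lessI divide_strict_right_mono divide_pos_pos)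
  also have "\<dots> \<le> upper_density vol \<rho> 0 sparse_subgraph"
    unfolding upper_density_def \<rho>
    by (rule tendsto_le_Limsup[OF filterlim_inverse_blow_scale[OF s0]
          density_ratio_tendsto[OF M g k0 rescaled_even_tendsto]])
  finally show ?thesis
    using constant_normal_sparse_subgraph[OF M] FG
      blow_up_sparse_subgraph[OF M s1 k1 rescaled_odd_tendsto]
      blow_up_sparse_subgraph[OF M s0 k0 rescaled_even_tendsto] by blast
qed

end
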